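(* Let $\Omega\subseteq\mathbb{R}^n$ be an open set, let $1\le p<\infty$, and let $w$ be a continuous, bounded weight on $\Omega$. For every $r>0$ let $$\Omega_r:=\{x\in\Omega : |x|>r\},\qquad S_r:=\{x\in\Omega : |x|=r\},$$ and let $A_r$ denote the surface area of $S_r$ with respect to the weight $w$. If the embedding $W^{1,p}(\Omega,w)\to L^p(\Omega,w)$ is compact, then: (1) for every $\epsilon>0$ and $\delta>0$ there exists $R>0$ such that if $r\ge R$, then $$\mu_w(\Omega_r)\le\delta\,\mu_w(\{x\in\Omega : r-\epsilon\le|x|\le r\});$$ (2) if $A_r$ is positive and ultimately decreasing as $r\to+\infty$, then for every $\epsilon>0$ $$\lim_{r\to+\infty}\frac{A_{r+\epsilon}}{A_r}=0.$$
   Context: A weight on an open set $\Omega\subseteq\mathbb{R}^n$ is a real-valued measurable function $w$ on $\Omega$ that is a.e. positive and finite. Standing assumption on $w$: if $p>1$, then $w^{-1/(p-1)}\in L^1_{\mathrm{loc}}(\Omega)$; if $p=1$, then $\operatorname{ess\,sup}_{x\in B}\frac1{w(x)}<+\infty$ for every ball $B\subset\Omega$. (Under this assumption $L^p(\Omega,w)\subseteq L^1_{\mathrm{loc}}(\Omega)$.) $L^p(\Omega,w)$ is the space of measurable $u$ with $\|u\|_{L^p(\Omega,w)}=\left(\int_\Omega |u(x)|^p w(x)\,dx\right)^{1/p}<+\infty$. $W^{1,p}(\Omega,w)$ is the space of $u\in L^p(\Omega,w)$ whose first-order distributional derivatives belong to $L^p(\Omega,w)$, with norm $\left(\int_\Omega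 |u|^p w\,dx+\int_\Omega|\nabla u|^p w\,dx\right)^{1/p}$. For a Lebesgue measurable set $U$, $\mu_w(U)=\int_U w(x)\,dx$. The surface area of $S_r$ with respect to $w$ is $A_r=\int_{S_r} w\,d\sigma$, where $\sigma$ is the $(n-1)$-dimensional surface measure on the sphere of radius $r$ centered at the origin. *)

theory Defs
  imports "HOL-Probability.Essential_Supremum"
begin

definition weight :: "'a::euclidean_space set \<Rightarrow> ('a \<Rightarrow> real) \<Rightarrow> bool" where
  "weight \<Omega> w \<longleftrightarrow> w \<in> borel_measurable (lebesgue_on \<Omega>) \<and> (AE x in lebesgue_on \<Omega>. 0 < w x)"

definition locally_integrable :: "'a::euclidean_space set \<Rightarrow> ('a \<Rightarrow> real) \<Rightarrow> bool" where
  "locally_integrable \<Omega> f \<longleftrightarrow> (\<forall>K. compact K \<and> K \<subseteq> \<Omega> \<longrightarrow> set_integrable lebesgue K f)"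

definition admissible_weight :: "'a::euclidean_space set \<Rightarrow> real \<Rightarrow> ('a \<Rightarrow> real) \<Rightarrow> bool" where
  "admissible_weight \<Omega> p w \<longleftrightarrow> weight \<Omega> w \<and>
     (p > 1 \<longrightarrow> locally_integrable \<Omega> (\<lambda>x. w x powr (- 1 / (p - 1)))) \<and>
     (p = 1 \<longrightarrow> (\<forall>a r. 0 < r \<and> ball a r \<subseteq> \<Omega> \<longrightarrow>
        esssup (lebesgue_on (ball a r)) (\<lambda>x. ereal (1 / w x)) < \<infinity>))"

text \<open>The extended nonnegative integral keeps the value \<open>\<infinity>\<close> for sets of infinite weighted
  measure, where the Bochner integral would be \<open>0\<close>.\<close>

definition weighted_measure :: "('a::euclidean_space \<Rightarrow> real) \<Rightarrow> 'a set \<Rightarrow> ennreal" where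
  "weighted_measure w U = (\<integral>\<^sup>+x\<in>U. ennreal (w x) \<partial>lebesgue)"

text \<open>Functions are used in place of their classes modulo equality almost everywhere, so the
  norms below are seminorms. The value of \<open>u\<close> outside \<open>\<Omega>\<close> is irrelevant.\<close>

definition weighted_Lp :: "'a::euclidean_space set \<Rightarrow> ('a \<Rightarrow> real) \<Rightarrow> real \<Rightarrow> ('a \<Rightarrow> real) set" where
  "weighted_Lp \<Omega> w p = {u \<in> borel_measurable (lebesgue_on \<Omega>).
     integrable (lebesgue_on \<Omega>) (\<lambda>x. \<bar>u x\<bar> powr p * w x)}"

definition weighted_Lp_norm :: "'a::euclidean_space set \<Rightarrow> ('a \<Rightarrow> real) \<Rightarrow> real \<Rightarrow> ('a \<Rightarrow> real) \<Rightarrow> real" where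
  "weighted_Lp_norm \<Omega> w p u = (LINT x|lebesgue_on \<Omega>. \<bar>u x\<bar> powr p * w x) powr (1 / p)"

primrec times_continuously_differentiable ::
  "nat \<Rightarrow> ('a::euclidean_space \<Rightarrow> real) \<Rightarrow> bool" where
  "times_continuously_differentiable 0 f \<longleftrightarrow> continuous_on UNIV f"
| "times_continuously_differentiable (Suc k) f \<longleftrightarrow>
     (\<forall>x. f differentiable (at x)) \<and>
     (\<forall>b\<in>Basis. times_continuously_differentiable k (\<lambda>x. frechet_derivative f (at x) b))"

definition test_function :: "'a::euclidean_space set \<Rightarrow> ('a \<Rightarrow> real) \<Rightarrow> bool" where
  "test_function \<Omega> \<phi> \<longleftrightarrow> (\<forall>k. times_continuously_differentiable k \<phi>) \<and>
     compact (closure {x. \<phi> x \<noteq> 0}) \<and> closure {x. \<phi> x \<noteq> 0} \<subseteq> \<Omega>"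

text \<open>\<open>g\<close> represents the distributional derivative of \<open>u\<close> in the direction \<open>b\<close>.\<close>

definition has_weak_derivative ::
  "'a::euclidean_space set \<Rightarrow> 'a \<Rightarrow> ('a \<Rightarrow> real) \<Rightarrow> ('a \<Rightarrow> real) \<Rightarrow> bool" where
  "has_weak_derivative \<Omega> b u g \<longleftrightarrow> locally_integrable \<Omega> u \<and> locally_integrable \<Omega> g \<and>
     (\<forall>\<phi>. test_function \<Omega> \<phi> \<longrightarrow>
        (LINT x|lebesgue_on \<Omega>. u x * frechet_derivative \<phi> (at x) b) =
        - (LINT x|lebesgue_on \<Omega>. g x * \<phi> x))"

definition has_weak_gradient_Lp ::
  "'a::euclidean_space set \<Rightarrow> ('a \<Rightarrow> real) \<Rightarrow> real \<Rightarrow> ('a \<Rightarrow> real) \<Rightarrow> ('a \<Rightarrow> 'a) \<Rightarrow> bool" where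
  "has_weak_gradient_Lp \<Omega> w p u G \<longleftrightarrow>
     (\<forall>b\<in>Basis. has_weak_derivative \<Omega> b u (\<lambda>x. G x \<bullet> b) \<and> (\<lambda>x. G x \<bullet> b) \<in> weighted_Lp \<Omega> w p)"

definition weighted_Sobolev :: "'a::euclidean_space set \<Rightarrow> ('a \<Rightarrow> real) \<Rightarrow> real \<Rightarrow> ('a \<Rightarrow> real) set" where
  "weighted_Sobolev \<Omega> w p = {u \<in> weighted_Lp \<Omega> w p. \<exists>G. has_weak_gradient_Lp \<Omega> w p u G}"

text \<open>The weak gradient of \<open>u\<close> is unique only up to null sets, so the norm of \<open>u\<close> is written
  with a representative \<open>G\<close> of the gradient as an argument; its value does not depend on
  the choice of \<open>G\<close>.\<close>

definition weighted_Sobolev_norm ::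
  "'a::euclidean_space set \<Rightarrow> ('a \<Rightarrow> real) \<Rightarrow> real \<Rightarrow> ('a \<Rightarrow> real) \<Rightarrow> ('a \<Rightarrow> 'a) \<Rightarrow> real" where
  "weighted_Sobolev_norm \<Omega> w p u G =
     ((LINT x|lebesgue_on \<Omega>. \<bar>u x\<bar> powr p * w x) +
      (LINT x|lebesgue_on \<Omega>. norm (G x) powr p * w x)) powr (1 / p)"

text \<open>Compactness of the inclusion, which exists by the definition of the Sobolev space:
  every norm-bounded sequence has a subsequence that converges in \<open>L\<^sup>p\<close>.\<close>

definition compact_Sobolev_embedding :: "'a::euclidean_space set \<Rightarrow> ('a \<Rightarrow> real) \<Rightarrow> real \<Rightarrow> bool" where
  "compact_Sobolev_embedding \<Omega> w p \<longleftrightarrow>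
     (\<forall>u G. (\<forall>k::nat. u k \<in> weighted_Sobolev \<Omega> w p \<and> has_weak_gradient_Lp \<Omega> w p (u k) (G k)) \<and>
        bounded (range (\<lambda>k. weighted_Sobolev_norm \<Omega> w p (u k) (G k))) \<longrightarrow>
        (\<exists>v\<in>weighted_Lp \<Omega> w p. \<exists>s. strict_mono s \<and>
           (\<lambda>k. weighted_Lp_norm \<Omega> w p (\<lambda>x. u (s k) x - v x)) \<longlonglongrightarrow> 0))"

text \<open>The surface measure on the sphere of radius \<open>r > 0\<close> about the origin, as a Borel measure on
  the whole space: \<open>\<sigma>(E)\<close> is \<open>n / r\<close> times the volume of the cone
  \<open>{t *\<^sub>R y | y t. y \<in> E \<inter> sphere 0 r \<and> 0 < t \<le> 1}\<close>, the usual construction of the surface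
  measure of spheres in real analysis (Folland; Stein and Shakarchi). For \<open>n = 1\<close> it is the
  counting measure on \<open>{-r, r}\<close>.\<close>

definition sphere_measure :: "real \<Rightarrow> 'a::euclidean_space measure" where
  "sphere_measure r = scale_measure (ennreal (DIM('a) / r))
     (distr (restrict_space lborel (cball 0 r - {0})) borel (\<lambda>x. (r / norm x) *\<^sub>R x))"

lemma emeasure_sphere_measure:
  fixes E :: "'a::euclidean_space set"
  assumes "r > 0" "E \<in> sets borel"
  shows "emeasure (sphere_measure r) E = ennreal (DIM('a) / r) *
    emeasure lborel {t *\<^sub>R y | y t. y \<in> E \<inter> sphere 0 r \<and> 0 < t \<and> t \<le> 1}"
proof -
  let ?D = "cball 0 r - {0} :: 'a set" and ?f = "\<lambda>x::'a. (r / norm x) *\<^sub>R x"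
  have m: "?f \<in> restrict_space lborel ?D \<rightarrow>\<^sub>M borel"
    by (rule measurable_restrict_space1) simp
  have "?f -` E \<inter> ?D = {t *\<^sub>R y | y t. y \<in> E \<inter> sphere 0 r \<and> 0 < t \<and> t \<le> 1}" (is "_ = ?C")
  proof (intro equalityI subsetI)
    fix x assume "x \<in> ?f -` E \<inter> ?D"
    then have "x = (norm x / r) *\<^sub>R ?f x \<and> ?f x \<in> E \<inter> sphere 0 r \<and> 0 < norm x / r \<and> norm x / r \<le> 1"
      using assms(1) by auto
    then show "x \<in> ?C" by blast
  next
    fix x assume "x \<in> ?C"
    then obtain t y where "x = t *\<^sub>R y" "y \<in> E" "norm y = r" "0 < t" "t \<le> 1" by auto
    with assms(1) show "x \<in> ?f -` E \<inter> ?D" by (auto simp: mult_left_le_one_le)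
  qed
  moreover from this have "?C \<subseteq> ?D" by blast
  ultimately show ?thesis
    using assms m by (simp add: sphere_measure_def emeasure_distr space_restrict_space
        emeasure_restrict_space)
qed

definition weighted_surface_area :: "'a::euclidean_space set \<Rightarrow> ('a \<Rightarrow> real) \<Rightarrow> real \<Rightarrow> real" where
  "weighted_surface_area \<Omega> w r = (LINT x:{x \<in> \<Omega>. norm x = r}|sphere_measure r. w x)"

end

theory Submission
  imports Defs "HOL-Probability.Distributions"
begin

text \<open>
  Why the theorem holds. Compactness forbids mass from escaping to infinity: a sequence of
  functions of unit \<open>L\<^sup>p\<close>-norm whose supports leave every ball has no \<open>L\<^sup>p\<close>-convergent
  subsequence, since its limit would vanish on every ball. Hence such a sequence has unbounded
  gradients, which says quantitatively (lemma \<open>compact_embedding_tail\<close>): for each \<open>\<eta> > 0\<close>,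
  every Sobolev function \<open>u\<close> that vanishes on a sufficiently large ball satisfies
  \<open>\<integral>\<bar>u\<bar>\<^sup>p w \<le> \<eta> (\<integral>\<bar>u\<bar>\<^sup>p w + \<integral>\<bar>\<nabla>u\<bar>\<^sup>p w)\<close>.

  For (1) this is applied to \<open>u(x) = \<theta>((\<bar>x\<bar> - r + \<epsilon>) / \<epsilon>) exp(- l \<bar>x\<bar>)\<close>, where \<open>\<theta>\<close> is a cutoff
  that rises from \<open>0\<close> to \<open>1\<close> on the unit interval and \<open>0 < l \<le> 1\<close>. Testing with \<open>\<theta>\<close> alone would
  require \<open>\<mu>\<^sub>w(\<Omega>\<^sub>r)\<close> to be finite, which is part of the claim. The exponential makes \<open>\<bar>u\<bar>\<^sup>p\<close> integrable at
  little cost: outside the shell \<open>r - \<epsilon> \<le> \<bar>x\<bar> \<le> r\<close> one has \<open>\<bar>\<nabla>u\<bar> = l \<bar>u\<bar> \<le> \<bar>u\<bar>\<close>, so that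
  \<open>\<integral>\<bar>\<nabla>u\<bar>\<^sup>p w \<le> K\<^sup>p \<mu>\<^sub>w(shell) + \<integral>\<bar>u\<bar>\<^sup>p w\<close> with \<open>K = 4 / \<epsilon> + 1\<close>. For small \<open>\<eta>\<close> the terms
  \<open>\<integral>\<bar>u\<bar>\<^sup>p w\<close> on the right are absorbed, which leaves a bound that does not depend on \<open>l\<close>, and
  Fatou's lemma for \<open>l \<rightarrow> 0\<close> gives (1) (lemma \<open>weighted_tail_measure_decay\<close>). The test function is
  continuously differentiable, so that its weak gradient is the classical one; this needs
  only that the integral of a directional derivative of a compactly supported function is zero.

  For (2), integration in polar coordinates (lemma \<open>nn_integral_polar_coordinates\<close>) shows that the
  weighted measure of a spherical shell is the integral of \<open>A\<close> over its radii. With \<open>h = \<epsilon> / 2\<close> and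
  \<open>A\<close> decreasing, (1) at the radius \<open>r + h\<close> yields
  \<open>h A\<^sub>r\<^sub>+\<^sub>\<epsilon> \<le> \<mu>\<^sub>w(\<Omega>\<^sub>r\<^sub>+\<^sub>h) \<le> \<delta> \<mu>\<^sub>w(r \<le> \<bar>x\<bar> \<le> r + h) \<le> \<delta> h A\<^sub>r\<close>.
\<close>

section \<open>Classical and weak derivatives\<close>

text \<open>The difference quotients of \<open>f\<close> in the direction \<open>b\<close> integrate to zero by translation invariance.
  They converge pointwise to the derivative and, by the mean value theorem, are
  dominated by a constant on a ball, so the limit has integral zero as well. This replaces the
  usual argument with Fubini's theorem and one-dimensional integration by parts.\<close>

lemma integral_directional_derivative_eq_0:
  fixes f :: "'a::euclidean_space \<Rightarrow> real"
  assumes deriv: "\<And>x. (f has_derivative D x) (at x)"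
    and cont: "continuous_on UNIV (\<lambda>x. D x b)"
    and supp: "\<And>x. x \<notin> cball 0 R \<Longrightarrow> f x = 0"
  shows "(\<integral>x. D x b \<partial>lborel) = 0"
proof -
  define s where "s k x = (f (x + (1 / real (Suc k)) *\<^sub>R b) - f x) * real (Suc k)" for k x
  have contf: "continuous_on UNIV f"
    using deriv by (meson continuous_at_imp_continuous_on has_derivative_continuous)
  have intf: "integrable lborel f"
  proof -
    have "integrable lborel (\<lambda>x. indicator (cball 0 R) x *\<^sub>R f x)"
      by (rule borel_integrable_compact) (auto intro: continuous_on_subset[OF contf])
    moreover have "(\<lambda>x. indicator (cball 0 R) x *\<^sub>R f x) = f"
      using supp by (fastforce simp: indicator_def)
    ultimately show ?thesis by simp
  qed
  have shift: "integrable lborel (\<lambda>x. f (x + h))" "(\<integral>x. f (x + h) \<partial>lborel) = (\<integral>x. f x \<partial>lborel)" for h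
  proof -
    have *: "distr lborel borel ((+) h) = (lborel :: 'a measure)" by (rule lborel_distr_plus)
    have m: "f \<in> borel_measurable borel" using intf by auto
    have "(\<integral>x. f x \<partial>lborel) = (\<integral>x. f x \<partial>(distr lborel borel ((+) h)))" by (simp add: *)
    also have "\<dots> = (\<integral>x. f (x + h) \<partial>lborel)"
      by (subst integral_distr) (auto simp: m add.commute)
    finally show "(\<integral>x. f (x + h) \<partial>lborel) = (\<integral>x. f x \<partial>lborel)" by simp
    have "integrable (distr lborel borel ((+) h)) f" using intf by (simp add: *)
    then show "integrable lborel (\<lambda>x. f (x + h))"
      by (subst (asm) integrable_distr_eq) (auto simp: m add.commute)
  qed
  have "compact ((\<lambda>x. D x b) ` cball 0 (R + 2 * norm b))"
    by (intro compact_continuous_image continuous_on_subset[OF cont]) auto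
  then have "bounded ((\<lambda>x. D x b) ` cball 0 (R + 2 * norm b))" by (rule compact_imp_bounded)
  then obtain B where B: "\<And>x. x \<in> cball 0 (R + 2 * norm b) \<Longrightarrow> \<bar>D x b\<bar> \<le> B"
    unfolding bounded_iff by (metis imageI real_norm_def)
  \<comment> \<open>A step of the quotient has length at most \<open>norm b\<close>: outside the ball of radius \<open>R + norm b\<close> both
    values of \<open>f\<close> vanish, and from inside it the segment stays in the ball of radius
    \<open>R + 2 * norm b\<close>, where \<open>B\<close> bounds the derivative.\<close>
  have dom: "norm (s k x) \<le> indicator (cball 0 (R + norm b)) x *\<^sub>R B" for k x
  proof (cases "x \<in> cball 0 (R + norm b)")
    case False
    have "norm ((1 / real (Suc k)) *\<^sub>R b) \<le> norm b" by (simp add: divide_le_eq algebra_simps)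
    then have "norm x \<le> norm (x + (1 / real (Suc k)) *\<^sub>R b) + norm b"
      using norm_triangle_ineq4[of "x + (1 / real (Suc k)) *\<^sub>R b" "(1 / real (Suc k)) *\<^sub>R b"]
      unfolding add_diff_cancel_right' by linarith
    moreover have "R + norm b < norm x" "0 \<le> norm b" using False by simp_all
    ultimately have "R < norm (x + (1 / real (Suc k)) *\<^sub>R b)" "R < norm x" by linarith+
    then have "x + (1 / real (Suc k)) *\<^sub>R b \<notin> cball 0 R" "x \<notin> cball 0 R"
      unfolding mem_cball dist_0_norm by linarith+
    then show ?thesis using supp False by (simp add: s_def)
  next
    case True
    let ?h = "1 / real (Suc k)"
    have "\<exists>t\<in>{0<..<?h}. f (x + ?h *\<^sub>R b) - f (x + 0 *\<^sub>R b) = D (x + t *\<^sub>R b) ((?h - 0) *\<^sub>R b)"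
    proof (rule mvt_simple)
      fix t :: real
      have "((\<lambda>t. x + t *\<^sub>R b) has_derivative (\<lambda>h. h *\<^sub>R b)) (at t within {0..?h})"
        by (auto intro!: derivative_eq_intros)
      from has_derivative_compose[OF this deriv]
      show "((\<lambda>t. f (x + t *\<^sub>R b)) has_derivative (\<lambda>h. D (x + t *\<^sub>R b) (h *\<^sub>R b))) (at t within {0..?h})" .
    qed simp
    moreover have "D y ((?h - 0) *\<^sub>R b) = ?h * D y b" for y
      using has_derivative_linear[OF deriv, of y] by (simp add: linear_scale)
    ultimately have "\<exists>t\<in>{0<..<?h}. f (x + ?h *\<^sub>R b) - f x = ?h * D (x + t *\<^sub>R b) b" by simp
    then obtain t where t: "0 < t" "t < ?h" "f (x + ?h *\<^sub>R b) - f x = ?h * D (x + t *\<^sub>R b) b"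
      by (auto simp del: of_nat_Suc)
    have "s k x = D (x + t *\<^sub>R b) b" unfolding s_def t(3) by simp
    moreover have "t \<le> 1" using t by (smt (verit) divide_le_eq_1 of_nat_0_le_iff of_nat_Suc)
    then have "norm (t *\<^sub>R b) \<le> norm b" using t(1) by (simp add: mult_left_le_one_le)
    then have "x + t *\<^sub>R b \<in> cball 0 (R + 2 * norm b)"
      using True norm_triangle_ineq[of x "t *\<^sub>R b"] by (simp del: norm_scaleR)
    ultimately show ?thesis using B True by simp
  qed
  have lim: "(\<lambda>k. s k x) \<longlonglongrightarrow> D x b" for x
  proof -
    have "((\<lambda>t. x + t *\<^sub>R b) has_derivative (\<lambda>h. h *\<^sub>R b)) (at 0)"
      by (auto intro!: derivative_eq_intros)
    from has_derivative_compose[OF this, of f "D x"] deriv[of x]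
    have "((\<lambda>t. f (x + t *\<^sub>R b)) has_derivative (\<lambda>h. D x (h *\<^sub>R b))) (at 0)" by simp
    moreover have "(\<lambda>h. D x (h *\<^sub>R b)) = (\<lambda>h. h * D x b)"
      using deriv[of x] by (auto simp: has_derivative_linear linear_scale)
    ultimately have "((\<lambda>t. f (x + t *\<^sub>R b)) has_field_derivative D x b) (at 0)"
      unfolding has_field_derivative_def by (metis (no_types, lifting) ext mult.commute)
    then have "((\<lambda>h. (f (x + h *\<^sub>R b) - f x) / h) \<longlongrightarrow> D x b) (at 0)"
      by (simp add: has_field_derivative_iff)
    moreover have "filterlim (\<lambda>k. 1 / real (Suc k)) (at 0) sequentially"
      unfolding filterlim_at using LIMSEQ_inverse_real_of_nat by (auto simp: inverse_eq_divide)
    ultimately have "((\<lambda>k. (f (x + (1 / real (Suc k)) *\<^sub>R b) - f x) / (1 / real (Suc k))) \<longlongrightarrow> D x b) sequentially"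
      by (rule filterlim_compose)
    then show ?thesis by (simp add: s_def)
  qed
  have dint: "integrable lborel (\<lambda>x. indicator (cball 0 (R + norm b)) x *\<^sub>R B)"
    by (rule borel_integrable_compact) auto
  have mD: "(\<lambda>x. D x b) \<in> borel_measurable lborel"
    using borel_measurable_continuous_onI[OF cont] by simp
  have ms: "s k \<in> borel_measurable lborel" for k
    unfolding s_def using shift(1) intf by (intro borel_measurable_times borel_measurable_diff) auto
  have "(\<lambda>k. \<integral>x. s k x \<partial>lborel) \<longlonglongrightarrow> (\<integral>x. D x b \<partial>lborel)"
    by (rule integral_dominated_convergence[OF mD ms dint AE_I2 AE_I2]) (rule lim, rule dom)
  moreover have "(\<integral>x. s k x \<partial>lborel) = 0" for k
    unfolding s_def using shift intf by (simp add: Bochner_Integration.integral_diff del: of_nat_Suc)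
  ultimately show ?thesis by (simp add: LIMSEQ_const_iff)
qed

lemma integral_lebesgue_on_eq_lborel:
  fixes h :: "'a::euclidean_space \<Rightarrow> real"
  assumes "open \<Omega>" "h \<in> borel_measurable borel" "\<And>x. x \<notin> \<Omega> \<Longrightarrow> h x = 0"
  shows "(LINT x|lebesgue_on \<Omega>. h x) = (\<integral>x. h x \<partial>lborel)"
proof -
  have "(LINT x|lebesgue_on \<Omega>. h x) = (LINT x|lebesgue. indicator \<Omega> x *\<^sub>R h x)"
    using assms(1) by (subst integral_restrict_space) (auto)
  also have "(\<lambda>x. indicator \<Omega> x *\<^sub>R h x) = h" using assms(3) by (fastforce simp: indicator_def)
  finally show ?thesis using assms(2) by (simp add: integral_completion)
qed

lemma locally_integrable_continuous:
  assumes "continuous_on UNIV u"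
  shows "locally_integrable \<Omega> u"
  unfolding locally_integrable_def set_integrable_def
proof safe
  fix K :: "'a set" assume "compact K"
  then have "integrable lborel (\<lambda>x. indicator K x *\<^sub>R u x)"
    by (rule borel_integrable_compact) (rule continuous_on_subset[OF assms], simp)
  then show "integrable lebesgue (\<lambda>x. indicator K x *\<^sub>R u x)"
    by (subst integrable_completion) auto
qed

text \<open>Integration by parts: the product of \<open>u\<close> with a test function has compact support, so the
  integral of its derivative in the direction \<open>b\<close> is zero.\<close>

lemma C1_has_weak_derivative:
  fixes u :: "'a::euclidean_space \<Rightarrow> real"
  assumes "open \<Omega>" and b: "b \<in> Basis"
    and deriv: "\<And>x. (u has_derivative D x) (at x)"
    and cont: "continuous_on UNIV (\<lambda>x. D x b)"
  shows "has_weak_derivative \<Omega> b u (\<lambda>x. D x b)"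
  unfolding has_weak_derivative_def
proof (intro conjI allI impI)
  have contu: "continuous_on UNIV u"
    using deriv by (meson continuous_at_imp_continuous_on has_derivative_continuous)
  then show "locally_integrable \<Omega> u" "locally_integrable \<Omega> (\<lambda>x. D x b)"
    using cont by (auto intro: locally_integrable_continuous)
  fix \<phi> assume \<phi>: "test_function \<Omega> \<phi>"
  define P where "P x = frechet_derivative \<phi> (at x)" for x
  define S where "S = closure {x. \<phi> x \<noteq> 0}"
  have "times_continuously_differentiable (Suc 0) \<phi>" using \<phi> unfolding test_function_def by blast
  then have diff: "\<And>x. \<phi> differentiable (at x)" and contP: "continuous_on UNIV (\<lambda>x. P x b)"
    using b by (auto simp: P_def)
  have dP: "(\<phi> has_derivative P x) (at x)" for x
    using diff by (simp add: P_def frechet_derivative_works[symmetric])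
  have cont\<phi>: "continuous_on UNIV \<phi>"
    using dP by (meson continuous_at_imp_continuous_on has_derivative_continuous)
  have compS: "compact S" "S \<subseteq> \<Omega>" using \<phi> by (auto simp: test_function_def S_def)
  have out: "\<phi> x = 0" "P x b = 0" if "x \<notin> S" for x
  proof -
    show "\<phi> x = 0" using that closure_subset[of "{x. \<phi> x \<noteq> 0}"] by (auto simp: S_def)
    have "((\<lambda>_. 0) has_derivative P x) (at x)"
      by (rule has_derivative_transform_within_open[OF dP, of "- S"])
         (use that closure_subset[of "{x. \<phi> x \<noteq> 0}"] in \<open>auto simp: S_def\<close>)
    then have "P x = (\<lambda>_. 0)" by (rule has_derivative_unique) simp
    then show "P x b = 0" by simp
  qed
  obtain R where R: "S \<subseteq> cball 0 R"
    using bounded_subset_ballD[OF compact_imp_bounded[OF compS(1)], of 0] ball_subset_cball by blast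
  have prod: "((\<lambda>x. u x * \<phi> x) has_derivative (\<lambda>h. u x * P x h + D x h * \<phi> x)) (at x)" for x
    by (rule has_derivative_mult[OF deriv dP])
  have z: "(\<integral>x. u x * P x b + D x b * \<phi> x \<partial>lborel) = 0"
  proof (rule integral_directional_derivative_eq_0[OF prod])
    show "continuous_on UNIV (\<lambda>x. u x * P x b + D x b * \<phi> x)"
      by (intro continuous_intros contu contP cont cont\<phi>)
    show "u x * \<phi> x = 0" if "x \<notin> cball 0 R" for x using that R out(1)[of x] by (metis mult_zero_right subsetD)
  qed
  have int: "integrable lborel h" if "continuous_on UNIV h" "\<And>x. x \<notin> S \<Longrightarrow> h x = 0" for h :: "'a \<Rightarrow> real"
  proof -
    have "integrable lborel (\<lambda>x. indicator S x *\<^sub>R h x)"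
      by (rule borel_integrable_compact[OF compS(1)]) (rule continuous_on_subset[OF that(1)], simp)
    moreover have "(\<lambda>x. indicator S x *\<^sub>R h x) = h"
      using that(2) by (auto simp: indicator_def fun_eq_iff)
    ultimately show ?thesis by simp
  qed
  have i1: "integrable lborel (\<lambda>x. u x * P x b)"
    by (rule int) (simp_all add: continuous_on_mult contu contP out)
  have i2: "integrable lborel (\<lambda>x. D x b * \<phi> x)"
    by (rule int) (simp_all add: continuous_on_mult cont cont\<phi> out)
  have outside: "P x b = 0" "\<phi> x = 0" if "x \<notin> \<Omega>" for x
    using that compS(2) out by blast+
  have "(LINT x|lebesgue_on \<Omega>. u x * P x b) = (\<integral>x. u x * P x b \<partial>lborel)"
    using i1 outside by (intro integral_lebesgue_on_eq_lborel assms(1)) simp_all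
  also have "\<dots> = - (\<integral>x. D x b * \<phi> x \<partial>lborel)" using z i1 i2 by simp
  also have "(\<integral>x. D x b * \<phi> x \<partial>lborel) = (LINT x|lebesgue_on \<Omega>. D x b * \<phi> x)"
    using i2 outside by (intro integral_lebesgue_on_eq_lborel[symmetric] assms(1)) simp_all
  finally show "(LINT x|lebesgue_on \<Omega>. u x * frechet_derivative \<phi> (at x) b)
     = - (LINT x|lebesgue_on \<Omega>. D x b * \<phi> x)" by (simp add: P_def)
qed

text \<open>The norm is not differentiable at the origin; a profile \<open>\<psi>\<close> that is zero up to some \<open>a > 0\<close> makes
  the radial function constant there.\<close>

lemma radial_C1:
  fixes \<psi> \<psi>' :: "real \<Rightarrow> real"
  defines "G \<equiv> \<lambda>x::'a::euclidean_space. (\<psi>' (norm x) / norm x) *\<^sub>R x"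
  assumes deriv: "\<And>s. (\<psi> has_real_derivative \<psi>' s) (at s)"
    and cont: "continuous_on UNIV \<psi>'"
    and "0 < a" and zero: "\<And>s. s \<le> a \<Longrightarrow> \<psi> s = 0" "\<And>s. s \<le> a \<Longrightarrow> \<psi>' s = 0"
  shows "((\<lambda>x. \<psi> (norm x)) has_derivative (\<lambda>h. G x \<bullet> h)) (at x)"
    and "continuous_on UNIV G"
    and "norm (G x) = \<bar>\<psi>' (norm x)\<bar>"
proof -
  show "((\<lambda>x. \<psi> (norm x)) has_derivative (\<lambda>h. G x \<bullet> h)) (at x)"
  proof (cases "x = 0")
    case True
    have "((\<lambda>x. \<psi> (norm x)) has_derivative (\<lambda>h. 0)) (at x)"
      by (rule has_derivative_transform_within_open[of "\<lambda>_. 0" _ _ _ "ball 0 a"])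
        (use True \<open>0 < a\<close> zero(1) in auto)
    then show ?thesis using True by (simp add: G_def)
  next
    case False
    have "(\<psi> has_derivative (*) (\<psi>' (norm x))) (at (norm x))"
      using deriv by (simp add: has_field_derivative_def)
    from has_derivative_compose[OF has_derivative_norm[OF False] this]
    show ?thesis
      by (rule has_derivative_eq_rhs) (auto simp: G_def sgn_div_norm inner_commute divide_inverse)
  qed
  have "continuous_on (- {0}) G"
    unfolding G_def by (intro continuous_intros continuous_on_compose2[OF cont]) auto
  moreover have "continuous_on (ball 0 a) G"
    by (rule continuous_on_eq[OF continuous_on_const[of _ 0]]) (auto simp: G_def zero(2))
  ultimately have "continuous_on (- {0} \<union> ball 0 a) G"
    by (intro continuous_on_open_Un) auto
  moreover have "- {0} \<union> ball 0 a = (UNIV :: 'a set)" using \<open>0 < a\<close> by auto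
  ultimately show "continuous_on UNIV G" by simp
  show "norm (G x) = \<bar>\<psi>' (norm x)\<bar>"
    using zero(2)[of 0] \<open>0 < a\<close> by (cases "x = 0") (auto simp: G_def)
qed

section \<open>Sobolev functions that vanish on a large ball\<close>

lemma has_weak_derivative_cmult:
  assumes "has_weak_derivative \<Omega> b u g"
  shows "has_weak_derivative \<Omega> b (\<lambda>x. c * u x) (\<lambda>x. c * g x)"
  using assms unfolding has_weak_derivative_def locally_integrable_def
  by (simp add: set_integrable_mult_right mult.assoc)

lemma weighted_Lp_cmult:
  assumes "u \<in> weighted_Lp \<Omega> w p"
  shows "(\<lambda>x. c * u x) \<in> weighted_Lp \<Omega> w p"
  using assms unfolding weighted_Lp_def
  by (auto simp: abs_mult powr_mult mult.assoc)

lemma has_weak_gradient_Lp_scaleR: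
  assumes "has_weak_gradient_Lp \<Omega> w p u G"
  shows "has_weak_gradient_Lp \<Omega> w p (\<lambda>x. c * u x) (\<lambda>x. c *\<^sub>R G x)"
  using assms unfolding has_weak_gradient_Lp_def
  by (simp add: has_weak_derivative_cmult weighted_Lp_cmult)

text \<open>A crude substitute for Minkowski's inequality, sufficient to see that differences of
  \<open>L\<^sup>p\<close> functions have an integrable \<open>p\<close>-th power.\<close>

lemma powr_abs_diff_le:
  fixes a b p :: real
  assumes "0 \<le> p"
  shows "\<bar>a - b\<bar> powr p \<le> 2 powr p * (\<bar>a\<bar> powr p + \<bar>b\<bar> powr p)"
proof -
  have "\<bar>a - b\<bar> powr p \<le> (2 * max \<bar>a\<bar> \<bar>b\<bar>) powr p"
    using assms by (intro powr_mono2) auto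
  also have "\<dots> = 2 powr p * max \<bar>a\<bar> \<bar>b\<bar> powr p" by (simp add: powr_mult)
  also have "max \<bar>a\<bar> \<bar>b\<bar> powr p \<le> \<bar>a\<bar> powr p + \<bar>b\<bar> powr p" by (simp add: max_def)
  finally show ?thesis by simp
qed

text \<open>If this failed for some \<open>\<eta>\<close>, there would be counterexamples vanishing on balls of radius
  \<open>1, 2, 3, \<dots>\<close>. Normalised in \<open>L\<^sup>p\<close>, they are bounded in the Sobolev norm because
  \<open>\<integral>\<bar>\<nabla>u\<bar>\<^sup>p w\<close> is less than \<open>1 / \<eta>\<close>. The limit of a convergent subsequence vanishes on every
  ball, hence almost everywhere, although it is the limit of functions of norm one.\<close>

lemma compact_embedding_tail:
  assumes w: "weight \<Omega> w" and p: "1 \<le> p" and \<Omega>: "open \<Omega>"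
    and compact: "compact_Sobolev_embedding \<Omega> w p" and \<eta>: "0 < \<eta>"
  obtains R where "0 < R"
    "\<And>u G. \<lbrakk>u \<in> weighted_Lp \<Omega> w p; has_weak_gradient_Lp \<Omega> w p u G;
        \<And>x. x \<in> \<Omega> \<Longrightarrow> norm x \<le> R \<Longrightarrow> u x = 0\<rbrakk> \<Longrightarrow>
      (LINT x|lebesgue_on \<Omega>. \<bar>u x\<bar> powr p * w x)
        \<le> \<eta> * ((LINT x|lebesgue_on \<Omega>. \<bar>u x\<bar> powr p * w x) +
               (LINT x|lebesgue_on \<Omega>. norm (G x) powr p * w x))"
proof (rule ccontr)
  let ?M = "lebesgue_on \<Omega>"
  let ?I = "\<lambda>u. LINT x|?M. \<bar>u x\<bar> powr p * w x"
  let ?J = "\<lambda>G. LINT x|?M. norm (G x) powr p * w x"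
  let ?bad = "\<lambda>k u G. u \<in> weighted_Lp \<Omega> w p \<and> has_weak_gradient_Lp \<Omega> w p u G \<and>
        (\<forall>x\<in>\<Omega>. norm x \<le> real (Suc k) \<longrightarrow> u x = 0) \<and> \<eta> * (?I u + ?J G) < ?I u"
  assume contra: "\<not> thesis"
  have "\<exists>u G. ?bad k u G" for k
    using contra that[of "real (Suc k)"] by (meson not_le of_nat_0_less_iff zero_less_Suc)
  then have "\<forall>k. \<exists>u. \<exists>G. ?bad k u G" by blast
  from choice[OF this] obtain u where "\<forall>k. \<exists>G. ?bad k (u k) G" ..
  from choice[OF this] obtain G where "\<forall>k. ?bad k (u k) (G k)" ..
  then have bad: "?bad k (u k) (G k)" for k ..
  have wmeas: "w \<in> borel_measurable ?M" and wpos: "AE x in ?M. 0 < w x"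
    using w by (auto simp: weight_def)
  have nonneg: "AE x in ?M. 0 \<le> f x powr p * w x" for f :: "'a \<Rightarrow> real"
    using wpos by eventually_elim simp
  have I0: "0 \<le> ?I f" "0 \<le> ?J F" for f F
    by (rule integral_nonneg_AE[OF nonneg])+
  define I where "I k = ?I (u k)" for k
  define c where "c k = I k powr (- 1 / p)" for k
  have Ipos: "0 < I k" for k
  proof -
    have "0 \<le> \<eta> * (?I (u k) + ?J (G k))" using I0(1)[of "u k"] I0(2)[of "G k"] \<eta> by simp
    also have "\<dots> < ?I (u k)" using bad[of k] by blast
    finally show ?thesis by (simp add: I_def)
  qed
  have cp: "\<bar>c k\<bar> powr p * I k = 1" for k
  proof -
    have "\<bar>c k\<bar> powr p = I k powr (- 1 / p * p)" by (simp add: c_def powr_powr)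
    also have "\<dots> = inverse (I k)" using p Ipos[of k] by (simp add: powr_minus)
    finally show ?thesis using Ipos[of k] by simp
  qed
  define U where "U k x = c k * u k x" for k x
  define H where "H k x = c k *\<^sub>R G k x" for k x
  have U: "U k \<in> weighted_Lp \<Omega> w p" "has_weak_gradient_Lp \<Omega> w p (U k) (H k)" for k
    using bad[of k] weighted_Lp_cmult[of "u k" \<Omega> w p "c k"]
      has_weak_gradient_Lp_scaleR[of \<Omega> w p "u k" "G k" "c k"]
    unfolding U_def H_def by auto
  have U1: "?I (U k) = 1" for k
    using cp[of k] by (simp add: U_def I_def abs_mult powr_mult mult.assoc)
  have H1: "?J (H k) \<le> 1 / \<eta>" for k
  proof -
    have "?J (H k) = \<bar>c k\<bar> powr p * ?J (G k)"
      by (simp add: H_def powr_mult mult.assoc)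
    also have "\<dots> \<le> \<bar>c k\<bar> powr p * (I k / \<eta>)"
    proof (rule mult_left_mono)
      have "\<eta> * ?J (G k) \<le> \<eta> * (I k + ?J (G k))" using \<eta> Ipos[of k] by simp
      also have "\<dots> \<le> I k" using bad[of k] by (simp add: I_def)
      finally show "?J (G k) \<le> I k / \<eta>" using \<eta> by (simp add: field_simps)
    qed simp
    also have "\<dots> = 1 / \<eta>" using cp[of k] by simp
    finally show ?thesis .
  qed
  have "bounded (range (\<lambda>k. weighted_Sobolev_norm \<Omega> w p (U k) (H k)))"
  proof (rule boundedI)
    fix y assume "y \<in> range (\<lambda>k. weighted_Sobolev_norm \<Omega> w p (U k) (H k))"
    then obtain k where "y = (?I (U k) + ?J (H k)) powr (1 / p)"
      by (auto simp: weighted_Sobolev_norm_def)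
    then show "norm y \<le> (1 + 1 / \<eta>) powr (1 / p)"
      using H1[of k] U1[of k] I0(2)[of "H k"] p by (auto intro!: powr_mono2)
  qed
  moreover have "U k \<in> weighted_Sobolev \<Omega> w p" for k
    using U[of k] by (auto simp: weighted_Sobolev_def)
  ultimately have *: "(\<forall>k. U k \<in> weighted_Sobolev \<Omega> w p \<and> has_weak_gradient_Lp \<Omega> w p (U k) (H k)) \<and>
      bounded (range (\<lambda>k. weighted_Sobolev_norm \<Omega> w p (U k) (H k)))"
    using U(2) by simp
  obtain v s where v: "v \<in> weighted_Lp \<Omega> w p" and s: "strict_mono s"
    and lim: "(\<lambda>k. weighted_Lp_norm \<Omega> w p (\<lambda>x. U (s k) x - v x)) \<longlonglongrightarrow> 0"
    using compact[unfolded compact_Sobolev_embedding_def, THEN spec, THEN spec, THEN mp, OF *] by blast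
  define N where "N k = ?I (\<lambda>x. U (s k) x - v x)" for k
  have "(\<lambda>k. (N k powr (1 / p)) powr p) \<longlonglongrightarrow> 0 powr p"
    using lim p by (intro tendsto_powr2) (auto simp: weighted_Lp_norm_def N_def)
  moreover have "(N k powr (1 / p)) powr p = N k" for k
    using p I0(1) by (simp add: N_def powr_powr)
  ultimately have N0: "N \<longlonglongrightarrow> 0" using p by simp
  have meas: "U k \<in> borel_measurable ?M" "v \<in> borel_measurable ?M"
    and int: "integrable ?M (\<lambda>x. \<bar>U k x\<bar> powr p * w x)" "integrable ?M (\<lambda>x. \<bar>v x\<bar> powr p * w x)" for k
    using U(1)[of k] v by (auto simp: weighted_Lp_def)
  have intdiff: "integrable ?M (\<lambda>x. \<bar>U k x - v x\<bar> powr p * w x)" for k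
  proof (rule Bochner_Integration.integrable_bound)
    show "integrable ?M (\<lambda>x. 2 powr p * (\<bar>U k x\<bar> powr p * w x + \<bar>v x\<bar> powr p * w x))"
      using int by auto
    show "(\<lambda>x. \<bar>U k x - v x\<bar> powr p * w x) \<in> borel_measurable ?M"
      using meas wmeas by measurable
    show "AE x in ?M. norm (\<bar>U k x - v x\<bar> powr p * w x)
        \<le> norm (2 powr p * (\<bar>U k x\<bar> powr p * w x + \<bar>v x\<bar> powr p * w x))"
      using wpos
    proof eventually_elim
      case (elim x)
      have "\<bar>U k x - v x\<bar> powr p * w x \<le> 2 powr p * (\<bar>U k x\<bar> powr p + \<bar>v x\<bar> powr p) * w x"
        using elim p by (intro mult_right_mono powr_abs_diff_le) auto
      then show ?case using elim by (simp add: algebra_simps abs_mult)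
    qed
  qed
  \<comment> \<open>On a ball of radius \<open>m\<close> the functions \<open>U (s k)\<close> vanish for \<open>k \<ge> m\<close>, so there \<open>\<bar>v\<bar>\<close> equals
    \<open>\<bar>U (s k) - v\<bar>\<close>, whose \<open>L\<^sup>p\<close> norm tends to zero.\<close>
  have v0: "AE x in ?M. norm x \<le> real m \<longrightarrow> \<bar>v x\<bar> powr p * w x = 0" for m
  proof -
    let ?f = "\<lambda>x. indicator (cball 0 (real m) \<inter> \<Omega>) x *\<^sub>R (\<bar>v x\<bar> powr p * w x)"
    have fi: "integrable ?M ?f"
      using \<Omega> by (intro integrable_mult_indicator int(2)) (auto simp: sets_restrict_space)
    have f0: "AE x in ?M. 0 \<le> ?f x" using wpos by eventually_elim simp
    have "integral\<^sup>L ?M ?f \<le> N k" if "m \<le> k" for k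
      unfolding N_def
    proof (rule integral_mono_AE[OF fi intdiff])
      have "m \<le> s k" using that strict_mono_imp_increasing[OF s, of k] by simp
      show "AE x in ?M. ?f x \<le> \<bar>U (s k) x - v x\<bar> powr p * w x"
        using wpos AE_space
      proof eventually_elim
        case (elim x)
        show ?case
        proof (cases "norm x \<le> real m")
          case True
          then have "U (s k) x = 0"
            using bad[of "s k"] elim(2) \<open>m \<le> s k\<close> by (simp add: U_def)
          then show ?thesis using True elim by (simp add: indicator_def)
        qed (use elim in simp)
      qed
    qed
    then have "integral\<^sup>L ?M ?f \<le> 0"
      by (intro LIMSEQ_le_const[OF N0]) blast
    then have "AE x in ?M. ?f x = 0"
      using integral_nonneg_eq_0_iff_AE[OF fi f0] integral_nonneg_AE[OF f0] by linarith
    then show ?thesis using AE_space by eventually_elim (auto simp: indicator_def)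
  qed
  have "AE x in ?M. \<forall>m. norm x \<le> real m \<longrightarrow> \<bar>v x\<bar> powr p * w x = 0"
    unfolding AE_all_countable using v0 by blast
  with wpos have vz: "AE x in ?M. v x = 0"
  proof eventually_elim
    case (elim x)
    then show ?case using real_arch_simple[of "norm x"] by auto
  qed
  have "N k = 1" for k
  proof -
    have "N k = ?I (U (s k))"
      unfolding N_def
    proof (rule integral_cong_AE)
      show "AE x in ?M. \<bar>U (s k) x - v x\<bar> powr p * w x = \<bar>U (s k) x\<bar> powr p * w x"
        using vz by eventually_elim simp
    qed (use int intdiff in auto)
    then show ?thesis using U1 by simp
  qed
  then have "N = (\<lambda>_. 1)" by auto
  with N0 show False by (simp add: LIMSEQ_const_iff)
qed

section \<open>Decay of the weighted measure at infinity\<close>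

text \<open>Layer-cake formula: \<open>exp(- c \<bar>x\<bar>)\<close> is the integral of \<open>exp(- t)\<close> over \<open>t \<ge> c \<bar>x\<bar>\<close>. After exchanging
  the integrals, the inner one is the volume of a ball of radius \<open>t / c\<close>, and a Gamma integral
  remains.\<close>

lemma integrable_exp_minus_norm:
  fixes c :: real
  assumes "0 < c"
  shows "integrable lborel (\<lambda>x::'a::euclidean_space. exp (- c * norm x))"
proof (rule integrableI_bounded)
  show "(\<lambda>x::'a. exp (- c * norm x)) \<in> borel_measurable lborel" by measurable
  let ?V = "unit_ball_vol (DIM('a)) / c ^ (DIM('a))"
  have "(\<integral>\<^sup>+(x::'a). ennreal (norm (exp (- c * norm x))) \<partial>lborel)
      = (\<integral>\<^sup>+(x::'a). (\<integral>\<^sup>+t. ennreal (exp (- t)) * indicator {c * norm x ..} t \<partial>lborel) \<partial>lborel)"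
  proof (rule nn_integral_cong)
    fix x :: 'a
    have "(\<integral>\<^sup>+t. ennreal (exp (- t)) * indicator {c * norm x ..} t \<partial>lborel)
        = ennreal (0 - (- exp (- (c * norm x))))"
    proof (rule nn_integral_FTC_atLeast)
      show "((\<lambda>t::real. - exp (- t)) \<longlongrightarrow> 0) at_top"
        using tendsto_minus[OF filterlim_compose[OF exp_at_bot filterlim_uminus_at_bot_at_top]]
        by simp
    qed (auto intro!: derivative_eq_intros)
    then show "ennreal (norm (exp (- c * norm x)))
        = (\<integral>\<^sup>+t. ennreal (exp (- t)) * indicator {c * norm x ..} t \<partial>lborel)" by simp
  qed
  also have "\<dots> = (\<integral>\<^sup>+t. (\<integral>\<^sup>+(x::'a). ennreal (exp (- t)) * indicator {c * norm x ..} t \<partial>lborel) \<partial>lborel)"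
    by (rule lborel_pair.Fubini') (simp add: indicator_def split_beta')
  also have "\<dots> = (\<integral>\<^sup>+t. ennreal ?V * (ennreal (t ^ (DIM('a)) * exp (- t)) * indicator {0..} t) \<partial>lborel)"
  proof (rule nn_integral_cong)
    fix t :: real
    have "(\<integral>\<^sup>+(x::'a). ennreal (exp (- t)) * indicator {c * norm x ..} t \<partial>lborel)
        = (\<integral>\<^sup>+(x::'a). ennreal (exp (- t)) * indicator (cball 0 (t / c)) x \<partial>lborel)"
      using assms by (intro nn_integral_cong) (auto simp: indicator_def field_simps)
    also have "\<dots> = ennreal (exp (- t)) * emeasure lborel (cball (0::'a) (t / c))"
      by (intro nn_integral_cmult_indicator) simp
    also have "\<dots> = ennreal ?V * (ennreal (t ^ (DIM('a)) * exp (- t)) * indicator {0..} t)"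
    proof (cases "0 \<le> t")
      case True
      then show ?thesis using assms
        by (simp add: emeasure_cball ennreal_mult[symmetric] power_divide field_simps)
    next
      case False
      then have "cball (0::'a) (t / c) = {}" using assms by (simp add: divide_less_0_iff)
      then show ?thesis using False by simp
    qed
    finally show "(\<integral>\<^sup>+(x::'a). ennreal (exp (- t)) * indicator {c * norm x ..} t \<partial>lborel)
      = ennreal ?V * (ennreal (t ^ (DIM('a)) * exp (- t)) * indicator {0..} t)" .
  qed
  also have "\<dots> = ennreal ?V * ennreal (fact (DIM('a)))"
    by (subst nn_integral_cmult) (simp_all add: nn_intergal_power_times_exp_Ici)
  also have "\<dots> < \<infinity>" by (simp add: ennreal_mult_less_top)
  finally show "(\<integral>\<^sup>+(x::'a). ennreal (norm (exp (- c * norm x))) \<partial>lborel) < \<infinity>" .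
qed

text \<open>The \<open>p\<close>-th power of \<open>f\<close> is again dominated by a decaying exponential, which is integrable
  over the whole space, and the bounded weight contributes only a constant factor.\<close>

lemma weighted_Lp_exponential_decay:
  fixes f :: "'a::euclidean_space \<Rightarrow> real"
  assumes \<Omega>: "open \<Omega>" and w: "weight \<Omega> w" "bounded (w ` \<Omega>)" and p: "1 \<le> p"
    and f: "f \<in> borel_measurable borel" "\<And>x. \<bar>f x\<bar> \<le> C * exp (- c * norm x)" and c: "0 < c"
  shows "f \<in> weighted_Lp \<Omega> w p"
proof -
  let ?M = "lebesgue_on \<Omega>"
  obtain B where B: "\<And>x. x \<in> \<Omega> \<Longrightarrow> \<bar>w x\<bar> \<le> B" using w(2) by (auto simp: bounded_iff)
  have wm: "w \<in> borel_measurable ?M" using w(1) by (simp add: weight_def)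
  have fm: "f \<in> borel_measurable ?M"
    using f(1) by (intro measurable_restrict_space1 measurable_completion) simp
  have "0 \<le> C" using f(2)[of 0] by (simp add: order_trans[OF abs_ge_zero])
  have "integrable lborel (\<lambda>x::'a. exp (- (c * p) * norm x))"
    using c p by (intro integrable_exp_minus_norm) simp
  then have "integrable lebesgue (\<lambda>x::'a. exp (- (c * p) * norm x))"
    by (subst integrable_completion) auto
  then have "integrable ?M (\<lambda>x. exp (- (c * p) * norm x))"
    using \<Omega> by (subst integrable_restrict_space) (simp, rule integrable_mult_indicator, simp)
  then have int: "integrable ?M (\<lambda>x. C powr p * B * exp (- (c * p) * norm x))" by simp
  have "integrable ?M (\<lambda>x. \<bar>f x\<bar> powr p * w x)"
  proof (rule Bochner_Integration.integrable_bound[OF int])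
    show "(\<lambda>x. \<bar>f x\<bar> powr p * w x) \<in> borel_measurable ?M" using fm wm by measurable
    show "AE x in ?M. norm (\<bar>f x\<bar> powr p * w x) \<le> norm (C powr p * B * exp (- (c * p) * norm x))"
    proof (rule AE_I2)
      fix x assume "x \<in> space ?M"
      then have "x \<in> \<Omega>" by simp
      have "\<bar>f x\<bar> powr p \<le> (C * exp (- c * norm x)) powr p"
        using f(2) p by (intro powr_mono2) auto
      also have "\<dots> = C powr p * exp (- (c * p) * norm x)"
        by (simp add: powr_mult exp_powr_real algebra_simps)
      finally have "\<bar>f x\<bar> powr p * \<bar>w x\<bar> \<le> C powr p * exp (- (c * p) * norm x) * B"
        using B[OF \<open>x \<in> \<Omega>\<close>] by (intro mult_mono) auto
      moreover have "0 \<le> B" using B[OF \<open>x \<in> \<Omega>\<close>] by linarith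
      ultimately show "norm (\<bar>f x\<bar> powr p * w x) \<le> norm (C powr p * B * exp (- (c * p) * norm x))"
        by (simp add: abs_mult algebra_simps)
    qed
  qed
  then show ?thesis using fm by (simp add: weighted_Lp_def)
qed

text \<open>The square \<open>q\<close> of the positive part is continuously differentiable, and so is
  \<open>\<theta>(t) = 1 - q(1 - q(t))\<close>: it is \<open>0\<close> for \<open>t \<le> 0\<close> because \<open>q(t) = 0\<close>, and \<open>1\<close> for \<open>t \<ge> 1\<close> because then
  \<open>q(t) \<ge> 1\<close>.\<close>

lemma C1_cutoff_exists:
  obtains \<theta> \<theta>' :: "real \<Rightarrow> real" where
    "\<And>t. (\<theta> has_real_derivative \<theta>' t) (at t)" "continuous_on UNIV \<theta>'"
    "\<And>t. 0 \<le> \<theta> t" "\<And>t. \<theta> t \<le> 1"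
    "\<And>t. t \<le> 0 \<Longrightarrow> \<theta> t = 0" "\<And>t. 1 \<le> t \<Longrightarrow> \<theta> t = 1"
    "\<And>t. t \<le> 0 \<Longrightarrow> \<theta>' t = 0" "\<And>t. 1 \<le> t \<Longrightarrow> \<theta>' t = 0" "\<And>t. \<bar>\<theta>' t\<bar> \<le> 4"
proof
  define q :: "real \<Rightarrow> real" where "q t = (max 0 t)\<^sup>2" for t
  let ?\<theta> = "\<lambda>t. 1 - q (1 - q t)" and ?\<theta>' = "\<lambda>t. 4 * max 0 (1 - q t) * max 0 t"
  have dq: "(q has_real_derivative 2 * max 0 t) (at t)" for t
  proof (cases t "0 :: real" rule: linorder_cases)
    case less
    show ?thesis
      by (rule has_field_derivative_transform_within_open[of "\<lambda>_. 0" _ _ "{..<0}"])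
        (use less in \<open>auto simp: q_def\<close>)
  next
    case equal
    have "((\<lambda>h. max 0 h * (max 0 h / h)) \<longlongrightarrow> 0) (at (0::real))"
    proof (rule Lim_null_comparison)
      show "\<forall>\<^sub>F h in at (0::real). norm (max 0 h * (max 0 h / h)) \<le> \<bar>h\<bar>"
        by (rule always_eventually) (auto simp: max_def)
      show "((\<lambda>h::real. \<bar>h\<bar>) \<longlongrightarrow> 0) (at 0)" by (rule tendsto_eq_intros refl | simp)+
    qed
    then show ?thesis using equal
      by (simp add: has_field_derivative_iff q_def power2_eq_square)
  next
    case greater
    show ?thesis
      by (rule has_field_derivative_transform_within_open[of "\<lambda>t. t\<^sup>2" _ _ "{0<..}"])
        (use greater in \<open>auto simp: q_def intro!: derivative_eq_intros\<close>)
  qed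
  have contq: "continuous_on UNIV q" unfolding q_def by (intro continuous_intros)
  show "(?\<theta> has_real_derivative ?\<theta>' t) (at t)" for t
    by (rule derivative_eq_intros DERIV_chain'[OF _ dq] dq refl)+ (simp add: DERIV_chain')
  show "continuous_on UNIV ?\<theta>'" by (intro continuous_intros contq)
  have q01: "0 \<le> q t" for t by (simp add: q_def)
  have qle: "q t \<le> 1" if "t \<le> 1" for t using that by (auto simp: q_def max_def power_le_one)
  show "0 \<le> ?\<theta> t" "?\<theta> t \<le> 1" for t using q01 qle[of "1 - q t"] by simp_all
  show "t \<le> 0 \<Longrightarrow> ?\<theta> t = 0" "t \<le> 0 \<Longrightarrow> ?\<theta>' t = 0" for t by (simp_all add: q_def)
  have q1: "1 \<le> q t" if "1 \<le> t" for t using that by (simp add: q_def max_def one_le_power)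
  show "1 \<le> t \<Longrightarrow> ?\<theta> t = 1" "1 \<le> t \<Longrightarrow> ?\<theta>' t = 0" for t
    using q1[of t] by (simp_all add: q_def[of "1 - q t"])
  show "\<bar>?\<theta>' t\<bar> \<le> 4" for t
  proof (cases "t \<le> 1")
    case True
    then have "max 0 (1 - q t) * max 0 t \<le> 1 * 1" using q01[of t] by (intro mult_mono) auto
    then show ?thesis by (simp add: abs_mult)
  next
    case False
    then show ?thesis using q1[of t] by simp
  qed
qed

text \<open>With \<open>I = \<integral>\<bar>u\<bar>\<^sup>p w\<close> for the test function \<open>u\<close> described at the top and \<open>m\<close> the weighted measure of
  the shell, the tail estimate reads \<open>I \<le> \<eta> (2 I + K\<^sup>p m)\<close>. For \<open>\<eta> \<le> 1 / 4\<close> this gives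
  \<open>I \<le> 2 \<eta> K\<^sup>p m\<close>, which is at most \<open>\<delta> m\<close> if also \<open>\<eta> \<le> \<delta> / (2 K\<^sup>p)\<close>.\<close>

lemma weighted_tail_measure_decay:
  fixes \<Omega> :: "'a::euclidean_space set"
  assumes \<Omega>: "open \<Omega>" and w: "weight \<Omega> w" "bounded (w ` \<Omega>)" and p: "1 \<le> p"
    and compact: "compact_Sobolev_embedding \<Omega> w p" and \<epsilon>: "0 < \<epsilon>" and \<delta>: "0 < \<delta>"
  shows "\<exists>R>0. \<forall>r\<ge>R. weighted_measure w {x \<in> \<Omega>. norm x > r}
      \<le> ennreal \<delta> * weighted_measure w {x \<in> \<Omega>. r - \<epsilon> \<le> norm x \<and> norm x \<le> r}"
proof -
  let ?M = "lebesgue_on \<Omega>"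
  obtain \<theta> \<theta>' :: "real \<Rightarrow> real" where d\<theta>: "\<And>t. (\<theta> has_real_derivative \<theta>' t) (at t)"
    and cont\<theta>': "continuous_on UNIV \<theta>'" and \<theta>: "\<And>t. 0 \<le> \<theta> t" "\<And>t. \<theta> t \<le> 1"
    "\<And>t. t \<le> 0 \<Longrightarrow> \<theta> t = 0" "\<And>t. 1 \<le> t \<Longrightarrow> \<theta> t = 1"
    and \<theta>': "\<And>t. t \<le> 0 \<Longrightarrow> \<theta>' t = 0" "\<And>t. 1 \<le> t \<Longrightarrow> \<theta>' t = 0" "\<And>t. \<bar>\<theta>' t\<bar> \<le> 4"
    using C1_cutoff_exists by blast
  have cont\<theta>: "continuous_on UNIV \<theta>"
    using d\<theta> by (meson DERIV_isCont continuous_at_imp_continuous_on)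
  define K where "K = 4 / \<epsilon> + 1"
  have K: "0 < K" using \<epsilon> by (simp add: K_def add_pos_pos)
  define \<eta> where "\<eta> = min (1 / 4) (\<delta> / (2 * K powr p))"
  have "0 < \<eta>" "\<eta> \<le> 1 / 4" "\<eta> \<le> \<delta> / (2 * K powr p)" using K \<delta> by (simp_all add: \<eta>_def)
  then have \<eta>: "0 < \<eta>" "2 * \<eta> \<le> 1 / 2" "2 * (\<eta> * K powr p) \<le> \<delta>"
    using K by (simp_all add: field_simps)
  obtain R0 where "0 < R0" and tail: "\<And>u G. \<lbrakk>u \<in> weighted_Lp \<Omega> w p; has_weak_gradient_Lp \<Omega> w p u G;
        \<And>x. x \<in> \<Omega> \<Longrightarrow> norm x \<le> R0 \<Longrightarrow> u x = 0\<rbrakk> \<Longrightarrow>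
      (LINT x|?M. \<bar>u x\<bar> powr p * w x)
        \<le> \<eta> * ((LINT x|?M. \<bar>u x\<bar> powr p * w x) + (LINT x|?M. norm (G x) powr p * w x))"
    using compact_embedding_tail[OF w(1) p \<Omega> compact \<eta>(1)] by blast
  have wpos: "AE x in ?M. 0 < w x" and wm: "w \<in> borel_measurable ?M"
    using w(1) by (simp_all add: weight_def)
  have wmeas: "weighted_measure w {x \<in> \<Omega>. P x} = (\<integral>\<^sup>+x. ennreal (w x) * indicator {x. P x} x \<partial>?M)" for P
    using \<Omega> unfolding weighted_measure_def
    by (subst nn_integral_restrict_space) (auto intro!: nn_integral_cong simp: indicator_def)
  have claim: "weighted_measure w {x \<in> \<Omega>. norm x > r}
      \<le> ennreal \<delta> * weighted_measure w {x \<in> \<Omega>. r - \<epsilon> \<le> norm x \<and> norm x \<le> r}"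
    if r: "R0 + \<epsilon> \<le> r" for r
  proof -
    define a where "a = r - \<epsilon>"
    have a: "0 < a" "R0 \<le> a" using r \<open>0 < R0\<close> by (simp_all add: a_def)
    define S where "S = {x::'a. r - \<epsilon> \<le> norm x \<and> norm x \<le> r}"
    define m where "m = (LINT x|?M. indicator S x * w x)"
    have Sm: "S \<in> sets borel" unfolding S_def by measurable
    \<comment> \<open>The shell is bounded, so its indicator function is dominated by a decaying exponential.\<close>
    have "(indicator S :: 'a \<Rightarrow> real) \<in> weighted_Lp \<Omega> w p"
    proof (rule weighted_Lp_exponential_decay[OF \<Omega> w p])
      show "\<bar>indicator S x :: real\<bar> \<le> exp r * exp (- 1 * norm x)" for x
        by (auto simp: indicator_def S_def exp_add[symmetric])
    qed (use Sm in auto)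
    moreover have "\<bar>indicator S x\<bar> powr p = (indicator S x :: real)" for x
      using p by (simp add: indicator_def)
    ultimately have intS: "integrable ?M (\<lambda>x. indicator S x * w x)" by (simp add: weighted_Lp_def)
    have nonneg: "AE x in ?M. 0 \<le> f x * w x" if "\<And>x. 0 \<le> f x" for f :: "'a \<Rightarrow> real"
      using wpos by eventually_elim (simp add: that)
    have m: "weighted_measure w {x \<in> \<Omega>. r - \<epsilon> \<le> norm x \<and> norm x \<le> r} = ennreal m"
    proof -
      have "ennreal m = (\<integral>\<^sup>+x. ennreal (indicator S x * w x) \<partial>?M)"
        unfolding m_def by (rule nn_integral_eq_integral[OF intS, symmetric]) (rule nonneg, simp)
      also have "\<dots> = (\<integral>\<^sup>+x. ennreal (w x) * indicator S x \<partial>?M)"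
        by (intro nn_integral_cong) (simp add: indicator_def)
      finally show ?thesis by (simp add: wmeas S_def)
    qed
    have main: "(\<integral>\<^sup>+x. ennreal (exp (- (l * p) * norm x) * w x) * indicator {x. norm x > r} x \<partial>?M)
        \<le> ennreal (\<delta> * m)" if l: "0 < l" "l \<le> 1" for l
    proof -
      define \<psi> where "\<psi> s = \<theta> ((s - a) / \<epsilon>) * exp (- l * s)" for s
      define \<psi>' where "\<psi>' s = (\<theta>' ((s - a) / \<epsilon>) / \<epsilon> - l * \<theta> ((s - a) / \<epsilon>)) * exp (- l * s)" for s
      define G where "G x = (\<psi>' (norm x) / norm x) *\<^sub>R x" for x :: 'a
      have d\<psi>: "(\<psi> has_real_derivative \<psi>' s) (at s)" for s
      proof -
        have "((\<lambda>s. \<theta> ((s - a) / \<epsilon>)) has_real_derivative \<theta>' ((s - a) / \<epsilon>) * (1 / \<epsilon>)) (at s)"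
          using \<epsilon> by (intro DERIV_chain2[OF d\<theta>]) (auto intro!: derivative_eq_intros)
        then show ?thesis unfolding \<psi>_def \<psi>'_def
          by (auto intro!: derivative_eq_intros simp: algebra_simps)
      qed
      have cont\<psi>: "continuous_on UNIV \<psi>" unfolding \<psi>_def
        using \<epsilon> by (intro continuous_intros continuous_on_compose2[OF cont\<theta>]) auto
      have cont\<psi>': "continuous_on UNIV \<psi>'" unfolding \<psi>'_def
        using \<epsilon> by (intro continuous_intros continuous_on_compose2[OF cont\<theta>] continuous_on_compose2[OF cont\<theta>']) auto
      have \<psi>0: "\<psi> s = 0" "\<psi>' s = 0" if "s \<le> a" for s
      proof -
        have "(s - a) / \<epsilon> \<le> 0" using that \<epsilon> by (simp add: divide_le_0_iff)
        then show "\<psi> s = 0" "\<psi>' s = 0" by (simp_all add: \<psi>_def \<psi>'_def \<theta> \<theta>')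
      qed
      have \<psi>_le: "\<bar>\<psi> s\<bar> \<le> 1 * exp (- l * s)" for s
        using \<theta>(1,2) by (simp add: \<psi>_def abs_mult)
      have \<psi>'_le: "\<bar>\<psi>' s\<bar> \<le> K * exp (- l * s)" for s
      proof -
        have "\<bar>\<theta>' ((s - a) / \<epsilon>) / \<epsilon>\<bar> \<le> 4 / \<epsilon>" using \<theta>'(3) \<epsilon> by (simp add: divide_right_mono)
        moreover have "\<bar>l * \<theta> ((s - a) / \<epsilon>)\<bar> \<le> 1 * 1"
          unfolding abs_mult using l \<theta>(1,2) by (intro mult_mono) auto
        ultimately have "\<bar>\<theta>' ((s - a) / \<epsilon>) / \<epsilon> - l * \<theta> ((s - a) / \<epsilon>)\<bar> \<le> K"
          unfolding K_def by linarith
        then show ?thesis by (simp add: \<psi>'_def abs_mult)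
      qed
      \<comment> \<open>On the shell the bound by \<open>K\<close> is used. Elsewhere \<open>\<theta>\<close> is locally constant and only the
        exponential contributes to the derivative.\<close>
      have grad: "\<bar>\<psi>' (norm x)\<bar> powr p \<le> K powr p * indicator S x + \<bar>\<psi> (norm x)\<bar> powr p" for x
      proof (cases "x \<in> S")
        case True
        have "K * exp (- l * norm x) \<le> K * 1" using K l by (intro mult_left_mono) auto
        then have "\<bar>\<psi>' (norm x)\<bar> \<le> K" using \<psi>'_le[of "norm x"] by simp
        then have "\<bar>\<psi>' (norm x)\<bar> powr p \<le> K powr p" using p by (intro powr_mono2) auto
        then show ?thesis using True by (simp add: add_increasing2)
      next
        case False
        then have "(norm x - a) / \<epsilon> \<le> 0 \<or> 1 \<le> (norm x - a) / \<epsilon>"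
          using \<epsilon> by (auto simp: S_def a_def divide_le_0_iff)
        then have "\<theta>' ((norm x - a) / \<epsilon>) = 0" using \<theta>' by blast
        then have "\<bar>\<psi>' (norm x)\<bar> = l * \<bar>\<psi> (norm x)\<bar>"
          using l by (simp add: \<psi>_def \<psi>'_def abs_mult)
        also have "\<dots> \<le> \<bar>\<psi> (norm x)\<bar>" using l by (simp add: mult_left_le_one_le)
        finally have "\<bar>\<psi>' (norm x)\<bar> powr p \<le> \<bar>\<psi> (norm x)\<bar> powr p" using p by (intro powr_mono2) auto
        then show ?thesis using False by simp
      qed
      have radial: "((\<lambda>x. \<psi> (norm x)) has_derivative (\<lambda>h. G x \<bullet> h)) (at x)"
        "continuous_on UNIV G" "norm (G x) = \<bar>\<psi>' (norm x)\<bar>" for x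
        unfolding G_def[abs_def] by (rule radial_C1[OF d\<psi> cont\<psi>' a(1) \<psi>0]; assumption)+
      have contG: "continuous_on UNIV (\<lambda>x. G x \<bullet> b)" for b
        by (intro continuous_intros radial(2))
      have u: "(\<lambda>x. \<psi> (norm x)) \<in> weighted_Lp \<Omega> w p"
        by (rule weighted_Lp_exponential_decay[OF \<Omega> w p _ \<psi>_le l(1)])
          (intro borel_measurable_continuous_onI continuous_on_compose2[OF cont\<psi>]
            continuous_intros subset_UNIV)
      have u': "(\<lambda>x. \<psi>' (norm x)) \<in> weighted_Lp \<Omega> w p"
        by (rule weighted_Lp_exponential_decay[OF \<Omega> w p _ \<psi>'_le l(1)])
          (intro borel_measurable_continuous_onI continuous_on_compose2[OF cont\<psi>']
            continuous_intros subset_UNIV)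
      have "has_weak_gradient_Lp \<Omega> w p (\<lambda>x. \<psi> (norm x)) G"
        unfolding has_weak_gradient_Lp_def
      proof (intro ballI conjI)
        fix b :: 'a assume b: "b \<in> Basis"
        show "has_weak_derivative \<Omega> b (\<lambda>x. \<psi> (norm x)) (\<lambda>x. G x \<bullet> b)"
          by (rule C1_has_weak_derivative[OF \<Omega> b radial(1) contG])
        have le: "\<bar>G x \<bullet> b\<bar> \<le> K * exp (- l * norm x)" for x
          using Basis_le_norm[OF b, of "G x"] radial(3)[of x] \<psi>'_le[of "norm x"] by linarith
        show "(\<lambda>x. G x \<bullet> b) \<in> weighted_Lp \<Omega> w p"
          by (rule weighted_Lp_exponential_decay[OF \<Omega> w p _ le l(1)])
            (rule borel_measurable_continuous_onI[OF contG])
      qed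
      then have "(LINT x|?M. \<bar>\<psi> (norm x)\<bar> powr p * w x)
        \<le> \<eta> * ((LINT x|?M. \<bar>\<psi> (norm x)\<bar> powr p * w x) + (LINT x|?M. norm (G x) powr p * w x))"
        (is "?I \<le> \<eta> * (?I + ?J)")
        using \<psi>0(1) a(2) by (intro tail[OF u]) auto
      moreover have "?J \<le> K powr p * m + ?I"
      proof -
        have intu: "integrable ?M (\<lambda>x. \<bar>\<psi> (norm x)\<bar> powr p * w x)"
          and intu': "integrable ?M (\<lambda>x. \<bar>\<psi>' (norm x)\<bar> powr p * w x)"
          using u u' by (simp_all add: weighted_Lp_def)
        have "?J = (LINT x|?M. \<bar>\<psi>' (norm x)\<bar> powr p * w x)" by (simp add: radial(3))
        also have "\<dots> \<le> (LINT x|?M. K powr p * (indicator S x * w x) + \<bar>\<psi> (norm x)\<bar> powr p * w x)"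
        proof (rule integral_mono_AE[OF intu'])
          show "AE x in ?M. \<bar>\<psi>' (norm x)\<bar> powr p * w x
              \<le> K powr p * (indicator S x * w x) + \<bar>\<psi> (norm x)\<bar> powr p * w x"
            using wpos
          proof eventually_elim
            case (elim x)
            then have "\<bar>\<psi>' (norm x)\<bar> powr p * w x \<le> (K powr p * indicator S x + \<bar>\<psi> (norm x)\<bar> powr p) * w x"
              by (intro mult_right_mono grad) simp
            then show ?case by (simp add: algebra_simps)
          qed
        qed (use intu intS in simp)
        also have "\<dots> = K powr p * m + ?I" using intu intS by (simp add: m_def)
        finally show ?thesis .
      qed
      ultimately have "?I \<le> \<eta> * (?I + (K powr p * m + ?I))"
        using \<eta>(1) by (meson add_left_mono less_imp_le mult_left_mono order_trans)
      then have "?I \<le> 2 * \<eta> * ?I + \<eta> * K powr p * m" by (simp add: algebra_simps)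
      moreover have m0: "0 \<le> m" and I0: "0 \<le> ?I"
        unfolding m_def by (rule integral_nonneg_AE, rule nonneg, simp)+
      moreover have "2 * \<eta> * ?I \<le> 1 / 2 * ?I" using \<eta>(2) I0 by (rule mult_right_mono)
      ultimately have "?I \<le> 2 * (\<eta> * K powr p) * m" by simp
      also have "\<dots> \<le> \<delta> * m" using \<eta>(3) m0 by (rule mult_right_mono)
      finally have I: "?I \<le> \<delta> * m" .
      have "(\<integral>\<^sup>+x. ennreal (exp (- (l * p) * norm x) * w x) * indicator {x. norm x > r} x \<partial>?M)
          \<le> (\<integral>\<^sup>+x. ennreal (\<bar>\<psi> (norm x)\<bar> powr p * w x) \<partial>?M)"
      proof (rule nn_integral_mono)
        fix x
        show "ennreal (exp (- (l * p) * norm x) * w x) * indicator {x. norm x > r} x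
            \<le> ennreal (\<bar>\<psi> (norm x)\<bar> powr p * w x)"
        proof (cases "r < norm x")
          case True
          then have "1 \<le> (norm x - a) / \<epsilon>" using \<epsilon> by (simp add: a_def)
          then have "\<bar>\<psi> (norm x)\<bar> powr p = exp (- (l * p) * norm x)"
            by (simp add: \<psi>_def \<theta>(4) exp_powr_real algebra_simps)
          then show ?thesis by (simp add: indicator_def)
        qed simp
      qed
      also have "\<dots> = ennreal ?I"
        using u by (intro nn_integral_eq_integral nonneg) (simp_all add: weighted_Lp_def)
      also have "\<dots> \<le> ennreal (\<delta> * m)" using I by (rule ennreal_leI)
      finally show ?thesis .
    qed
    \<comment> \<open>The bound in \<open>main\<close> is uniform in \<open>l\<close>, so \<open>l = 1 / (k + 1)\<close> can tend to zero.\<close>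
    define f where "f k x = ennreal (exp (- (1 / real (Suc k) * p) * norm x) * w x) * indicator {x. norm x > r} x" for k and x :: 'a
    have lim: "(\<lambda>k. f k x) \<longlonglongrightarrow> ennreal (w x) * indicator {x. norm x > r} x" for x
    proof (cases "r < norm x")
      case True
      have "(\<lambda>k. 1 / real (Suc k)) \<longlonglongrightarrow> 0" using LIMSEQ_inverse_real_of_nat by (simp add: inverse_eq_divide)
      then have "(\<lambda>k. exp (- (1 / real (Suc k) * p) * norm x) * w x) \<longlonglongrightarrow> exp (- (0 * p) * norm x) * w x"
        by (intro tendsto_intros)
      then show ?thesis using True unfolding f_def by (simp add: tendsto_ennrealI del: of_nat_Suc)
    qed (simp add: f_def)
    have fm: "f k \<in> borel_measurable ?M" for k
    proof -
      have "(\<lambda>x::'a. exp (- (1 / real (Suc k) * p) * norm x)) \<in> borel_measurable ?M"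
        "(\<lambda>x::'a. indicator {x. norm x > r} x :: ennreal) \<in> borel_measurable ?M"
        by (intro measurable_restrict_space1 measurable_completion; measurable)+
      then show ?thesis unfolding f_def using wm
        by (intro borel_measurable_times_ennreal measurable_compose[OF _ measurable_ennreal] borel_measurable_times)
    qed
    have "weighted_measure w {x \<in> \<Omega>. norm x > r} = (\<integral>\<^sup>+x. liminf (\<lambda>k. f k x) \<partial>?M)"
      unfolding wmeas using lim by (intro nn_integral_cong lim_imp_Liminf[symmetric]) simp_all
    also have "\<dots> \<le> liminf (\<lambda>k. \<integral>\<^sup>+x. f k x \<partial>?M)" by (rule nn_integral_liminf[OF fm])
    also have "\<dots> \<le> ennreal (\<delta> * m)"
      unfolding f_def by (intro Liminf_le always_eventually allI main) simp_all
    also have "\<dots> = ennreal \<delta> * ennreal m" using \<delta> by (simp add: ennreal_mult')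
    finally show ?thesis using m by simp
  qed
  show ?thesis using claim \<epsilon> \<open>0 < R0\<close> by (intro exI[of _ "R0 + \<epsilon>"]) auto
qed

section \<open>Integration in polar coordinates\<close>

lemma nn_integral_lborel_scaleR:
  fixes f :: "'a::euclidean_space \<Rightarrow> ennreal"
  assumes [measurable]: "f \<in> borel_measurable borel" and "0 < t"
  shows "(\<integral>\<^sup>+x. f (t *\<^sub>R x) \<partial>lborel) = ennreal (1 / t ^ DIM('a)) * (\<integral>\<^sup>+x. f x \<partial>lborel)"
proof -
  have "(\<integral>\<^sup>+x. f x \<partial>lborel)
      = (\<integral>\<^sup>+x. f x \<partial>density (distr lborel borel (\<lambda>x. 0 + t *\<^sub>R x)) (\<lambda>_. \<bar>t\<bar> ^ DIM('a)))"
    using \<open>0 < t\<close> by (subst lborel_affine[of t 0]) simp_all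
  also have "\<dots> = ennreal (t ^ DIM('a)) * (\<integral>\<^sup>+x. f (t *\<^sub>R x) \<partial>lborel)"
    using \<open>0 < t\<close> by (simp add: nn_integral_density nn_integral_distr nn_integral_cmult)
  finally have "ennreal (1 / t ^ DIM('a)) * (\<integral>\<^sup>+x. f x \<partial>lborel)
      = ennreal (1 / t ^ DIM('a)) * ennreal (t ^ DIM('a)) * (\<integral>\<^sup>+x. f (t *\<^sub>R x) \<partial>lborel)"
    by (simp only: mult.assoc)
  also have "ennreal (1 / t ^ DIM('a)) * ennreal (t ^ DIM('a)) = 1"
    using \<open>0 < t\<close> by (simp add: ennreal_mult[symmetric])
  finally show ?thesis by simp
qed

lemma sets_sphere_measure [measurable_cong]: "sets (sphere_measure r) = sets borel"
  by (simp add: sphere_measure_def)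

lemma space_sphere_measure: "space (sphere_measure r) = UNIV"
  by (simp add: sphere_measure_def space_scale_measure)

lemma nn_integral_sphere_measure:
  fixes f :: "'a::euclidean_space \<Rightarrow> ennreal"
  assumes [measurable]: "f \<in> borel_measurable borel"
  shows "(\<integral>\<^sup>+y. f y \<partial>sphere_measure r) = ennreal (DIM('a) / r) *
    (\<integral>\<^sup>+x. f ((r / norm x) *\<^sub>R x) * indicator (cball 0 r - {0}) x \<partial>lborel)"
proof -
  have "(\<lambda>x::'a. (r / norm x) *\<^sub>R x) \<in> restrict_space lborel (cball 0 r - {0}) \<rightarrow>\<^sub>M borel"
    by (rule measurable_restrict_space1) simp
  then show ?thesis
    by (simp add: sphere_measure_def nn_integral_scale_measure nn_integral_distr
        nn_integral_restrict_space)
qed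

text \<open>The sphere measure is a multiple of the image of Lebesgue measure on a punctured ball under
  \<open>x \<mapsto> r x / \<bar>x\<bar>\<close>, and all values of this map have norm \<open>r\<close>.\<close>

lemma AE_sphere_measure:
  assumes "0 < r"
  shows "AE y in sphere_measure r. norm (y::'a::euclidean_space) = r"
proof -
  have "emeasure (sphere_measure r) {y::'a. norm y \<noteq> r} = 0"
  proof -
    have [measurable]: "{y::'a. norm y \<noteq> r} \<in> sets borel" by measurable
    have "emeasure (sphere_measure r) {y::'a. norm y \<noteq> r}
        = (\<integral>\<^sup>+y. indicator {y::'a. norm y \<noteq> r} y \<partial>sphere_measure r)"
      by (simp add: sets_sphere_measure)
    also have "\<dots> = ennreal (DIM('a) / r) * (\<integral>\<^sup>+x. indicator {y::'a. norm y \<noteq> r}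
        ((r / norm x) *\<^sub>R x) * indicator (cball 0 r - {0}) x \<partial>lborel)"
      by (rule nn_integral_sphere_measure) simp
    moreover have "indicator {y. norm y \<noteq> r} ((r / norm x) *\<^sub>R x) * indicator (cball 0 r - {0}) x = (0::ennreal)"
      for x :: 'a using assms by (cases "x = 0") simp_all
    ultimately show ?thesis by simp
  qed
  then show ?thesis
    by (intro AE_I[of _ _ "{y. norm y \<noteq> r}"]) (auto simp: sets_sphere_measure)
qed

text \<open>The definition of the sphere measure by cones turns the right-hand side into the double
  integral of \<open>(n / r) f(r x / \<bar>x\<bar>)\<close> over \<open>0 < \<bar>x\<bar> \<le> r\<close>. Integrating over \<open>r\<close> first and substituting
  \<open>r = \<bar>x\<bar> t\<close> gives \<open>(n / t) f(t x)\<close> over \<open>t \<ge> 1\<close>; integrating over \<open>x\<close> first then gives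
  \<open>n / t\<^bsup>n + 1\<^esup>\<close> times the integral of \<open>f\<close>, and \<open>n / t\<^bsup>n + 1\<^esup>\<close> has integral \<open>1\<close> over \<open>t \<ge> 1\<close>.\<close>

lemma nn_integral_polar_coordinates:
  fixes f :: "'a::euclidean_space \<Rightarrow> ennreal"
  assumes [measurable]: "f \<in> borel_measurable borel"
  shows "(\<integral>\<^sup>+x. f x \<partial>lborel)
    = (\<integral>\<^sup>+r. (\<integral>\<^sup>+y. f y \<partial>sphere_measure r) * indicator {0<..} r \<partial>lborel)"
proof -
  let ?n = "real (DIM('a))"
  have "(\<integral>\<^sup>+r. (\<integral>\<^sup>+y. f y \<partial>sphere_measure r) * indicator {0<..} r \<partial>lborel)
      = (\<integral>\<^sup>+r. (\<integral>\<^sup>+(x::'a). ennreal (?n / r) * f ((r / norm x) *\<^sub>R x) *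
          indicator {(r, x). 0 < norm x \<and> norm x \<le> r} (r, x) \<partial>lborel) \<partial>lborel)"
  proof (rule nn_integral_cong)
    fix r :: real
    show "(\<integral>\<^sup>+y. f y \<partial>sphere_measure r) * indicator {0<..} r
      = (\<integral>\<^sup>+(x::'a). ennreal (?n / r) * f ((r / norm x) *\<^sub>R x) *
          indicator {(r, x). 0 < norm x \<and> norm x \<le> r} (r, x) \<partial>lborel)"
    proof (cases "0 < r")
      case True
      have "(\<integral>\<^sup>+y. f y \<partial>sphere_measure r) = (\<integral>\<^sup>+(x::'a). ennreal (?n / r) *
          (f ((r / norm x) *\<^sub>R x) * indicator (cball 0 r - {0}) x) \<partial>lborel)"
        by (subst nn_integral_sphere_measure, simp, rule nn_integral_cmult[symmetric],
            rule borel_measurable_times_ennreal, simp, rule borel_measurable_indicator, simp)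
      moreover have "indicator (cball 0 r - {0}) x
          = (indicator {(r, x). 0 < norm x \<and> norm x \<le> r} (r, x) :: ennreal)" for x :: 'a
        by (auto simp: indicator_def)
      ultimately show ?thesis using True by (simp add: mult.assoc)
    next
      case False
      then have "indicator {(r, x). 0 < norm x \<and> norm x \<le> r} (r, x) = (0::ennreal)" for x :: 'a
        using order_less_le_trans[of 0 "norm x" r] by (auto simp: indicator_def)
      with False show ?thesis by simp
    qed
  qed
  also have "\<dots> = (\<integral>\<^sup>+(x::'a). (\<integral>\<^sup>+r. ennreal (?n / r) * f ((r / norm x) *\<^sub>R x) *
          indicator {(r, x). 0 < norm x \<and> norm x \<le> r} (r, x) \<partial>lborel) \<partial>lborel)"
    by (rule lborel_pair.Fubini') simp
  also have "\<dots> = (\<integral>\<^sup>+(x::'a). (\<integral>\<^sup>+t. ennreal (?n / t) * f (t *\<^sub>R x) * indicator {1..} t \<partial>lborel) \<partial>lborel)"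
  proof (rule nn_integral_cong_AE)
    have "AE x::'a in lborel. x \<noteq> 0" by (rule AE_lborel_singleton)
    then show "AE x::'a in lborel. (\<integral>\<^sup>+r. ennreal (?n / r) * f ((r / norm x) *\<^sub>R x) *
          indicator {(r, x). 0 < norm x \<and> norm x \<le> r} (r, x) \<partial>lborel)
        = (\<integral>\<^sup>+t. ennreal (?n / t) * f (t *\<^sub>R x) * indicator {1..} t \<partial>lborel)"
    proof eventually_elim
      fix x :: 'a assume x: "x \<noteq> 0"
      have "(\<integral>\<^sup>+r. ennreal (?n / r) * f ((r / norm x) *\<^sub>R x) *
          indicator {(r, x). 0 < norm x \<and> norm x \<le> r} (r, x) \<partial>lborel)
        = ennreal (norm x) * (\<integral>\<^sup>+t. ennreal (?n / (0 + norm x * t)) * f (((0 + norm x * t) / norm x) *\<^sub>R x) *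
          indicator {(r, x). 0 < norm x \<and> norm x \<le> r} (0 + norm x * t, x) \<partial>lborel)"
        using x by (subst nn_integral_real_affine[where c="norm x" and t=0]) simp_all
      also have "\<dots> = (\<integral>\<^sup>+t. ennreal (norm x) * (ennreal (?n / (0 + norm x * t)) * f (((0 + norm x * t) / norm x) *\<^sub>R x) *
          indicator {(r, x). 0 < norm x \<and> norm x \<le> r} (0 + norm x * t, x)) \<partial>lborel)"
        by (rule nn_integral_cmult[symmetric]) simp
      also have "\<dots> = (\<integral>\<^sup>+t. ennreal (?n / t) * f (t *\<^sub>R x) * indicator {1..} t \<partial>lborel)"
      proof (rule nn_integral_cong)
        fix t :: real
        show "ennreal (norm x) * (ennreal (?n / (0 + norm x * t)) * f (((0 + norm x * t) / norm x) *\<^sub>R x) *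
            indicator {(r, x). 0 < norm x \<and> norm x \<le> r} (0 + norm x * t, x))
          = ennreal (?n / t) * f (t *\<^sub>R x) * indicator {1..} t"
        proof (cases "1 \<le> t")
          case True
          have "ennreal (norm x) * ennreal (?n / (norm x * t)) = ennreal (?n / t)"
            using True x by (simp add: ennreal_mult[symmetric])
          then show ?thesis using True x by (simp add: mult.assoc[symmetric])
        next
          case False
          then show ?thesis using x by (simp add: indicator_def)
        qed
      qed
      finally show "(\<integral>\<^sup>+r. ennreal (?n / r) * f ((r / norm x) *\<^sub>R x) *
          indicator {(r, x). 0 < norm x \<and> norm x \<le> r} (r, x) \<partial>lborel)
        = (\<integral>\<^sup>+t. ennreal (?n / t) * f (t *\<^sub>R x) * indicator {1..} t \<partial>lborel)" .
    qed
  qed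
  also have "\<dots> = (\<integral>\<^sup>+t. (\<integral>\<^sup>+(x::'a). ennreal (?n / t) * f (t *\<^sub>R x) * indicator {1..} t \<partial>lborel) \<partial>lborel)"
    by (rule lborel_pair.Fubini') simp
  also have "\<dots> = (\<integral>\<^sup>+t. (\<integral>\<^sup>+x. f x \<partial>lborel) * (ennreal (?n / t ^ Suc DIM('a)) * indicator {1..} t) \<partial>lborel)"
  proof (rule nn_integral_cong)
    fix t :: real
    show "(\<integral>\<^sup>+(x::'a). ennreal (?n / t) * f (t *\<^sub>R x) * indicator {1..} t \<partial>lborel)
        = (\<integral>\<^sup>+x. f x \<partial>lborel) * (ennreal (?n / t ^ Suc DIM('a)) * indicator {1..} t)"
    proof (cases "1 \<le> t")
      case True
      then have "(\<integral>\<^sup>+(x::'a). ennreal (?n / t) * f (t *\<^sub>R x) * indicator {1..} t \<partial>lborel)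
          = ennreal (?n / t) * (ennreal (1 / t ^ DIM('a)) * (\<integral>\<^sup>+x. f x \<partial>lborel))"
        by (simp add: nn_integral_cmult nn_integral_lborel_scaleR)
      also have "\<dots> = ennreal (?n / t * (1 / t ^ DIM('a))) * (\<integral>\<^sup>+x. f x \<partial>lborel)"
        using True by (subst ennreal_mult) (simp_all add: mult.assoc)
      finally show ?thesis using True by (simp add: mult.commute)
    qed simp
  qed
  also have "\<dots> = (\<integral>\<^sup>+x. f x \<partial>lborel) *
      (\<integral>\<^sup>+t. ennreal (?n / t ^ Suc DIM('a)) * indicator {1..} t \<partial>lborel)"
    by (rule nn_integral_cmult) simp
  also have "(\<integral>\<^sup>+t. ennreal (?n / t ^ Suc DIM('a)) * indicator {1..} t \<partial>lborel)
      = ennreal (0 - (- (1 / 1 ^ DIM('a))))"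
  proof (rule nn_integral_FTC_atLeast[where F="\<lambda>t. - (1 / t ^ DIM('a))" and T=0])
    fix t :: real assume "1 \<le> t"
    then show "((\<lambda>t. - (1 / t ^ DIM('a))) has_real_derivative ?n / t ^ Suc DIM('a)) (at t)"
      by (auto intro!: derivative_eq_intros simp: power_Suc[symmetric] field_simps
          power_add[symmetric] simp del: power_Suc)
    show "0 \<le> ?n / t ^ Suc DIM('a)" using \<open>1 \<le> t\<close> by simp
  next
    have "((\<lambda>t::real. - inverse (t ^ DIM('a))) \<longlongrightarrow> - 0) at_top"
      by (intro tendsto_minus tendsto_inverse_0_at_top filterlim_pow_at_top) (auto simp: filterlim_ident)
    then show "((\<lambda>t::real. - (1 / t ^ DIM('a))) \<longlongrightarrow> 0) at_top" by (simp add: inverse_eq_divide)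
  qed simp
  finally show ?thesis by simp
qed

section \<open>Decay of the weighted surface area\<close>

text \<open>Spheres are Lebesgue null sets, so positivity of \<open>w\<close> almost everywhere says nothing about its surface
  integrals. But by continuity the set where \<open>w\<close> is negative is open, and an open null set is empty.\<close>

lemma weight_nonneg:
  assumes "open \<Omega>" "weight \<Omega> w" "continuous_on \<Omega> w" "x \<in> \<Omega>"
  shows "0 \<le> w x"
proof (rule ccontr)
  let ?N = "{x \<in> \<Omega>. w x < 0}"
  assume "\<not> 0 \<le> w x"
  then have "?N \<noteq> {}" using assms(4) by auto
  have "open ?N"
    using continuous_open_preimage[OF assms(3,1), of "{..<0}"] by (simp add: vimage_def Int_def)
  moreover have "AE x in lebesgue_on \<Omega>. 0 < w x" using assms(2) by (simp add: weight_def)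
  then have "AE x in lebesgue. x \<in> \<Omega> \<longrightarrow> 0 < w x"
    using assms(1) by (simp add: AE_restrict_space_iff)
  then have "AE x in lebesgue. x \<notin> ?N" by eventually_elim auto
  then have "negligible ?N"
    using \<open>open ?N\<close> by (simp add: negligible_iff_null_sets AE_iff_null_sets)
  ultimately show False using open_not_negligible \<open>?N \<noteq> {}\<close> by blast
qed

text \<open>Finiteness of the sphere measure and boundedness of \<open>w\<close> make the Bochner integral that
  defines the surface area a genuine one, so it agrees with the extended nonnegative integral.\<close>

lemma ennreal_weighted_surface_area:
  fixes \<Omega> :: "'a::euclidean_space set"
  assumes "open \<Omega>" "continuous_on \<Omega> w" "bounded (w ` \<Omega>)"
    and nonneg: "\<And>x. x \<in> \<Omega> \<Longrightarrow> 0 \<le> w x" and "0 < r"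
  shows "ennreal (weighted_surface_area \<Omega> w r)
    = (\<integral>\<^sup>+x. ennreal (w x) * indicator {x \<in> \<Omega>. norm x = r} x \<partial>sphere_measure r)"
proof -
  let ?S = "{x \<in> \<Omega>. norm x = r}"
  have S: "?S = \<Omega> \<inter> sphere 0 r" by auto
  have meas: "(\<lambda>x. indicator ?S x *\<^sub>R w x) \<in> borel_measurable borel"
    unfolding S using assms(1) continuous_on_subset[OF assms(2), of "\<Omega> \<inter> sphere 0 r"]
    by (intro borel_measurable_continuous_on_indicator) auto
  obtain B where B: "\<And>x. x \<in> \<Omega> \<Longrightarrow> \<bar>w x\<bar> \<le> B"
    using assms(3) by (auto simp: bounded_iff)
  have fin: "emeasure (sphere_measure r) (UNIV :: 'a set) < \<infinity>"
  proof -
    have "emeasure (sphere_measure r) (UNIV :: 'a set)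
        = ennreal (DIM('a) / r) * (\<integral>\<^sup>+(x::'a). 1 * indicator (cball 0 r - {0}) x \<partial>lborel)"
      using nn_integral_sphere_measure[of "\<lambda>_::'a. 1" r] by (simp add: space_sphere_measure)
    also have "(\<integral>\<^sup>+(x::'a). 1 * indicator (cball 0 r - {0}) x \<partial>lborel) \<le> emeasure lborel (cball (0::'a) r)"
      by (auto intro!: emeasure_mono)
    also have "ennreal (DIM('a) / r) * \<dots> < \<infinity>"
      using emeasure_lborel_cball_finite[of "0::'a" r] by (simp add: ennreal_mult_less_top)
    finally show ?thesis by (simp add: mult_left_mono)
  qed
  have int: "integrable (sphere_measure r) (\<lambda>x. indicator ?S x *\<^sub>R w x)"
  proof (rule integrableI_bounded_set[where A=UNIV and B="\<bar>B\<bar>"])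
    show "AE x\<in>UNIV in sphere_measure r. norm (indicator ?S x *\<^sub>R w x) \<le> \<bar>B\<bar>"
      using B by (intro AE_I2) (force simp: indicator_def)
  qed (use fin meas in \<open>auto simp: sets_sphere_measure measurable_cong_sets[OF sets_sphere_measure refl]\<close>)
  have "ennreal (weighted_surface_area \<Omega> w r)
      = (\<integral>\<^sup>+x. ennreal (indicator ?S x *\<^sub>R w x) \<partial>sphere_measure r)"
    unfolding weighted_surface_area_def set_lebesgue_integral_def
    by (rule nn_integral_eq_integral[OF int, symmetric]) (auto simp: indicator_def nonneg)
  also have "\<dots> = (\<integral>\<^sup>+x. ennreal (w x) * indicator ?S x \<partial>sphere_measure r)"
    by (intro nn_integral_cong) (auto simp: indicator_def)
  finally show ?thesis .
qed

lemma weighted_measure_shell: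
  fixes \<Omega> :: "'a::euclidean_space set"
  assumes \<Omega>: "open \<Omega>" "continuous_on \<Omega> w" "bounded (w ` \<Omega>)"
    and nonneg: "\<And>x. x \<in> \<Omega> \<Longrightarrow> 0 \<le> w x" and T: "T \<in> sets borel" "T \<subseteq> {0<..}"
  shows "weighted_measure w {x \<in> \<Omega>. norm x \<in> T}
    = (\<integral>\<^sup>+r. ennreal (weighted_surface_area \<Omega> w r) * indicator T r \<partial>lborel)"
proof -
  let ?f = "\<lambda>x. ennreal (w x) * indicator {x \<in> \<Omega>. norm x \<in> T} x"
  have f: "?f \<in> borel_measurable borel"
  proof -
    have "(\<lambda>x. indicator \<Omega> x *\<^sub>R w x) \<in> borel_measurable borel"
      using \<Omega> by (intro borel_measurable_continuous_on_indicator) auto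
    moreover have "norm -` T \<in> sets (borel :: 'a measure)"
      using T(1) measurable_sets_borel[of norm borel T] by auto
    ultimately have "(\<lambda>x. ennreal (indicator \<Omega> x *\<^sub>R w x) * indicator (norm -` T) x) \<in> borel_measurable borel"
      by (intro borel_measurable_times_ennreal borel_measurable_indicator) simp_all
    moreover have "ennreal (indicator \<Omega> x *\<^sub>R w x) * indicator (norm -` T) x = ?f x" for x
      by (auto simp: indicator_def)
    ultimately show ?thesis by simp
  qed
  have "weighted_measure w {x \<in> \<Omega>. norm x \<in> T} = (\<integral>\<^sup>+x. ?f x \<partial>lborel)"
    by (simp add: weighted_measure_def nn_integral_completion)
  also have "\<dots> = (\<integral>\<^sup>+r. (\<integral>\<^sup>+y. ?f y \<partial>sphere_measure r) * indicator {0<..} r \<partial>lborel)"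
    by (rule nn_integral_polar_coordinates[OF f])
  also have "\<dots> = (\<integral>\<^sup>+r. ennreal (weighted_surface_area \<Omega> w r) * indicator T r \<partial>lborel)"
  proof (rule nn_integral_cong)
    fix r :: real
    show "(\<integral>\<^sup>+y. ?f y \<partial>sphere_measure r) * indicator {0<..} r
        = ennreal (weighted_surface_area \<Omega> w r) * indicator T r"
    proof (cases "0 < r")
      case True
      show ?thesis
      proof (cases "r \<in> T")
        case rT: True
        have "(\<integral>\<^sup>+y. ?f y \<partial>sphere_measure r)
            = (\<integral>\<^sup>+x. ennreal (w x) * indicator {x \<in> \<Omega>. norm x = r} x \<partial>sphere_measure r)"
          using AE_sphere_measure[OF True]
          by (intro nn_integral_cong_AE, eventually_elim) (use rT in \<open>auto simp: indicator_def\<close>)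
        then show ?thesis
          using ennreal_weighted_surface_area[OF \<Omega> nonneg True] True rT by simp
      next
        case rT: False
        have "(\<integral>\<^sup>+y. ?f y \<partial>sphere_measure r) = (\<integral>\<^sup>+(y::'a). 0 \<partial>sphere_measure r)"
          using AE_sphere_measure[OF True]
          by (intro nn_integral_cong_AE, eventually_elim) (use rT in \<open>auto simp: indicator_def\<close>)
        then show ?thesis using rT by simp
      qed
    next
      case False
      then show ?thesis using T(2) by (auto simp: indicator_def)
    qed
  qed
  finally show ?thesis .
qed

text \<open>A shell of thickness \<open>h = \<epsilon> / 2\<close> just outside the radius \<open>r + h\<close> has measure at least
  \<open>h A\<^sub>r\<^sub>+\<^sub>\<epsilon>\<close>, and the one just inside has measure at most \<open>h A\<^sub>r\<close>, because \<open>A\<close> is decreasing.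
  The decay of the weighted measure compares the two.\<close>

lemma tail_decay_imp_surface_area_ratio:
  fixes \<Omega> :: "'a::euclidean_space set"
  assumes \<Omega>: "open \<Omega>" "continuous_on \<Omega> w" "bounded (w ` \<Omega>)"
    and nonneg: "\<And>x. x \<in> \<Omega> \<Longrightarrow> 0 \<le> w x"
    and decay: "\<And>\<epsilon> \<delta>. 0 < \<epsilon> \<Longrightarrow> 0 < \<delta> \<Longrightarrow> \<exists>R>0. \<forall>r\<ge>R. weighted_measure w {x \<in> \<Omega>. norm x > r}
      \<le> ennreal \<delta> * weighted_measure w {x \<in> \<Omega>. r - \<epsilon> \<le> norm x \<and> norm x \<le> r}"
    and pos: "\<forall>\<^sub>F r in at_top. 0 < weighted_surface_area \<Omega> w r"
    and anti: "antimono_on {R0..} (weighted_surface_area \<Omega> w)"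
    and "0 < \<epsilon>"
  shows "((\<lambda>r. weighted_surface_area \<Omega> w (r + \<epsilon>) / weighted_surface_area \<Omega> w r) \<longlongrightarrow> 0) at_top"
proof (rule tendstoI)
  let ?A = "weighted_surface_area \<Omega> w"
  fix e :: real assume "0 < e"
  define h where "h = \<epsilon> / 2"
  have "0 < h" using \<open>0 < \<epsilon>\<close> by (simp add: h_def)
  obtain R where R: "\<And>r. R \<le> r \<Longrightarrow> weighted_measure w {x \<in> \<Omega>. norm x > r}
      \<le> ennreal (e / 2) * weighted_measure w {x \<in> \<Omega>. r - h \<le> norm x \<and> norm x \<le> r}"
    using decay[of h "e / 2"] \<open>0 < h\<close> \<open>0 < e\<close> by auto
  have anti': "?A t \<le> ?A s" if "R0 \<le> s" "s \<le> t" for s t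
    using anti that by (auto simp: monotone_on_def)
  have const: "(\<integral>\<^sup>+t. ennreal c * indicator {a..b} t \<partial>lborel) = ennreal (c * (b - a))"
    "(\<integral>\<^sup>+t. ennreal c * indicator {a<..b} t \<partial>lborel) = ennreal (c * (b - a))"
    if "0 \<le> c" "a \<le> b" for a b c :: real
    using that by (simp_all add: nn_integral_cmult_indicator ennreal_mult)
  show "\<forall>\<^sub>F r in at_top. dist (?A (r + \<epsilon>) / ?A r) 0 < e"
    using pos eventually_gt_at_top[of 0] eventually_ge_at_top[of R] eventually_ge_at_top[of R0]
  proof eventually_elim
    case (elim r)
    have Anonneg: "0 \<le> ?A (r + \<epsilon>)"
      unfolding weighted_surface_area_def set_lebesgue_integral_def
      by (rule integral_nonneg_AE) (auto simp: indicator_def nonneg)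
    have "ennreal (?A (r + \<epsilon>) * h) = (\<integral>\<^sup>+t. ennreal (?A (r + \<epsilon>)) * indicator {r + h<..r + \<epsilon>} t \<partial>lborel)"
      using \<open>0 < h\<close> Anonneg by (subst const(2)) (simp_all add: h_def)
    also have "\<dots> \<le> (\<integral>\<^sup>+t. ennreal (?A t) * indicator {r + h<..r + \<epsilon>} t \<partial>lborel)"
      using elim \<open>0 < h\<close> by (intro nn_integral_mono) (auto simp: indicator_def intro!: ennreal_leI anti')
    also have "\<dots> = weighted_measure w {x \<in> \<Omega>. norm x \<in> {r + h<..r + \<epsilon>}}"
      using elim \<open>0 < h\<close> by (intro weighted_measure_shell[symmetric] \<Omega> nonneg) auto
    also have "\<dots> \<le> weighted_measure w {x \<in> \<Omega>. norm x > r + h}"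
      unfolding weighted_measure_def by (intro nn_integral_mono) (auto simp: indicator_def)
    also have "\<dots> \<le> ennreal (e / 2) * weighted_measure w {x \<in> \<Omega>. norm x \<in> {r..r + h}}"
      using R[of "r + h"] elim \<open>0 < h\<close> by simp
    also have "weighted_measure w {x \<in> \<Omega>. norm x \<in> {r..r + h}}
        = (\<integral>\<^sup>+t. ennreal (?A t) * indicator {r..r + h} t \<partial>lborel)"
      using elim \<open>0 < h\<close> by (intro weighted_measure_shell \<Omega> nonneg) auto
    also have "\<dots> \<le> (\<integral>\<^sup>+t. ennreal (?A r) * indicator {r..r + h} t \<partial>lborel)"
      using elim \<open>0 < h\<close> by (intro nn_integral_mono) (auto simp: indicator_def intro!: ennreal_leI anti')
    also have "\<dots> = ennreal (?A r * h)"
      using elim \<open>0 < h\<close> by (subst const(1)) simp_all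
    also have "ennreal (e / 2) * ennreal (?A r * h) = ennreal (e / 2 * (?A r * h))"
      using elim \<open>0 < h\<close> \<open>0 < e\<close> by (intro ennreal_mult[symmetric]) simp_all
    finally have "ennreal (?A (r + \<epsilon>) * h) \<le> ennreal (e / 2 * (?A r * h))"
      by (simp add: mult_left_mono)
    then have "?A (r + \<epsilon>) * h \<le> e / 2 * (?A r * h)"
      using elim \<open>0 < h\<close> \<open>0 < e\<close> by (subst (asm) ennreal_le_iff) auto
    then have "?A (r + \<epsilon>) \<le> e / 2 * ?A r" using \<open>0 < h\<close> by simp
    also have "\<dots> < e * ?A r" using elim \<open>0 < e\<close> by simp
    finally show ?case using elim Anonneg by (simp add: divide_less_eq)
  qed
qed

theorem theorem3p4:
  fixes \<Omega> :: "(real ^ 'n) set" and w :: "real ^ 'n \<Rightarrow> real" and p :: real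
  assumes "open \<Omega>" and "1 \<le> p"
    and "admissible_weight \<Omega> p w"
    and "continuous_on \<Omega> w" and "bounded (w ` \<Omega>)"
    and "compact_Sobolev_embedding \<Omega> w p"
  shows "(\<forall>\<epsilon>>0. \<forall>\<delta>>0. \<exists>R>0. \<forall>r\<ge>R.
            weighted_measure w {x \<in> \<Omega>. norm x > r}
              \<le> ennreal \<delta> * weighted_measure w {x \<in> \<Omega>. r - \<epsilon> \<le> norm x \<and> norm x \<le> r})
       \<and> ((\<forall>\<^sub>F r in at_top. 0 < weighted_surface_area \<Omega> w r)
            \<and> (\<exists>R. antimono_on {R..} (weighted_surface_area \<Omega> w))
          \<longrightarrow> (\<forall>\<epsilon>>0. ((\<lambda>r. weighted_surface_area \<Omega> w (r + \<epsilon>) / weighted_surface_area \<Omega> w r)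
                          \<longlongrightarrow> 0) at_top))"
proof (intro conjI impI allI)
  have w: "weight \<Omega> w" using assms(3) by (simp add: admissible_weight_def)
  have decay: "\<exists>R>0. \<forall>r\<ge>R. weighted_measure w {x \<in> \<Omega>. norm x > r}
      \<le> ennreal \<delta> * weighted_measure w {x \<in> \<Omega>. r - \<epsilon> \<le> norm x \<and> norm x \<le> r}"
    if "0 < \<epsilon>" "0 < \<delta>" for \<epsilon> \<delta> :: real
    by (rule weighted_tail_measure_decay[OF assms(1) w assms(5,2,6) that])
  then show "\<exists>R>0. \<forall>r\<ge>R. weighted_measure w {x \<in> \<Omega>. norm x > r}
      \<le> ennreal \<delta> * weighted_measure w {x \<in> \<Omega>. r - \<epsilon> \<le> norm x \<and> norm x \<le> r}"
    if "0 < \<epsilon>" "0 < \<delta>" for \<epsilon> \<delta> :: real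
    using that by blast
  fix \<epsilon> :: real
  assume A: "(\<forall>\<^sub>F r in at_top. 0 < weighted_surface_area \<Omega> w r)
      \<and> (\<exists>R. antimono_on {R..} (weighted_surface_area \<Omega> w))" and "0 < \<epsilon>"
  then obtain R where R: "antimono_on {R..} (weighted_surface_area \<Omega> w)" by blast
  show "((\<lambda>r. weighted_surface_area \<Omega> w (r + \<epsilon>) / weighted_surface_area \<Omega> w r) \<longlongrightarrow> 0) at_top"
    using A weight_nonneg[OF assms(1) w assms(4)]
    by (intro tail_decay_imp_surface_area_ratio[OF assms(1,4,5) _ decay _ R \<open>0 < \<epsilon>\<close>]) auto
qed

end
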